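(* (Provable in $\mathsf{C}$.) If a structure $\mathfrak S$ is a set, then $\mathfrak S$ is satisfactory, i.e., the full satisfaction relation for $\mathfrak S$ exists.
   Context: $\mathsf{C}$ is Gödel–Bernays class theory $\mathsf{GB}$ with the Axiom of Infinity omitted (sets and classes, class comprehension only for formulas without bound class variables). A $\rho$-structure may be a proper class. For a class $\Phi$ of $\rho$-formulas, a $\Phi$-satisfaction relation for $\mathfrak S$ is the class of pairs $\langle\phi,A\rangle$ ($\phi$ a subformula of a member of $\Phi$, $A$ a finite function into $|\mathfrak S|$ whose domain includes the free variables of $\phi$) at which $\phi$ is true, according to a valuation obeying the usual Tarskian recursive clauses. $\mathfrak S$ is satisfactory if there exists an $\mathcal F^\rho$-satisfaction relation for $\mathfrak S$, where $\mathcal F^\rho$ is the class of all $\rho$-formulas. *)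

theory Defs
  imports Main
begin

text \<open>
  Sets are the elements of the type \<open>'s\<close>, and \<open>elts x\<close> is the collection of members of the set \<open>x\<close>.
  Classes are extensional, so a model of class theory is given by \<open>elts\<close> together with a family
  \<open>Cls\<close> of subsets of \<open>UNIV :: 's set\<close>.  The object theory only sees elements of \<open>'s\<close> and members
  of \<open>Cls\<close>; every notion below unfolds to a formula about these.  In particular, natural
  numbers, finiteness, terms and formulas are those of the model, which may be nonstandard.
\<close>

section \<open>Class-theoretic formulas without bound class variables\<close>

text \<open>Set variables and (free) class variables are numbered separately.\<close>

datatype cform =
    InSet nat nat
  | EqSet nat nat
  | InClass nat nat
  | Neg cform
  | Conj cform cform
  | ExSet nat cform

primrec holds :: "('s \<Rightarrow> 's set) \<Rightarrow> (nat \<Rightarrow> 's set) \<Rightarrow> (nat \<Rightarrow> 's) \<Rightarrow> cform \<Rightarrow> bool" where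
  "holds elts C x (InSet i j) \<longleftrightarrow> x i \<in> elts (x j)"
| "holds elts C x (EqSet i j) \<longleftrightarrow> x i = x j"
| "holds elts C x (InClass i j) \<longleftrightarrow> x i \<in> C j"
| "holds elts C x (Neg \<phi>) \<longleftrightarrow> \<not> holds elts C x \<phi>"
| "holds elts C x (Conj \<phi> \<psi>) \<longleftrightarrow> holds elts C x \<phi> \<and> holds elts C x \<psi>"
| "holds elts C x (ExSet i \<phi>) \<longleftrightarrow> (\<exists>a. holds elts C (x(i := a)) \<phi>)"


section \<open>Sets, functions, natural numbers\<close>

locale set_universe =
  fixes elts :: "'s \<Rightarrow> 's set"
begin

definition is_set :: "'s set \<Rightarrow> bool" where
  "is_set X \<longleftrightarrow> (\<exists>x. elts x = X)"

definition set_of :: "'s set \<Rightarrow> 's" where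
  "set_of X = (THE x. elts x = X)"

definition opair :: "'s \<Rightarrow> 's \<Rightarrow> 's" where
  "opair x y = set_of {set_of {x}, set_of {x, y}}"

definition zero :: 's where
  "zero = set_of {}"

definition succ :: "'s \<Rightarrow> 's" where
  "succ x = set_of (insert x (elts x))"

primrec num :: "nat \<Rightarrow> 's" where
  "num 0 = zero"
| "num (Suc k) = succ (num k)"

text \<open>
  Finite von Neumann ordinals: in the presence of Foundation, the first two conjuncts say
  that \<open>n\<close> is an ordinal.  The class of all of them need not be a set.
\<close>

definition is_nat :: "'s \<Rightarrow> bool" where
  "is_nat n \<longleftrightarrow>
     (\<forall>m \<in> elts n. elts m \<subseteq> elts n) \<and>
     (\<forall>m \<in> elts n. \<forall>k \<in> elts m. elts k \<subseteq> elts m) \<and>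
     (\<forall>m \<in> insert n (elts n). m = zero \<or> (\<exists>k. m = succ k))"

definition is_fun :: "'s \<Rightarrow> bool" where
  "is_fun f \<longleftrightarrow>
     (\<forall>p \<in> elts f. \<exists>x y. p = opair x y) \<and>
     (\<forall>x y z. opair x y \<in> elts f \<and> opair x z \<in> elts f \<longrightarrow> y = z)"

definition fdom :: "'s \<Rightarrow> 's set" where
  "fdom f = {x. \<exists>y. opair x y \<in> elts f}"

definition fapp :: "'s \<Rightarrow> 's \<Rightarrow> 's" where
  "fapp f x = (THE y. opair x y \<in> elts f)"

definition fupd :: "'s \<Rightarrow> 's \<Rightarrow> 's \<Rightarrow> 's" where
  "fupd f x a = set_of (insert (opair x a) {p \<in> elts f. \<not> (\<exists>y. p = opair x y)})"

definition is_finite :: "'s set \<Rightarrow> bool" where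
  "is_finite X \<longleftrightarrow>
     (\<exists>n g. is_nat n \<and> is_fun g \<and> fdom g = elts n \<and> bij_betw (fapp g) (elts n) X)"

definition finite_functions :: "'s set \<Rightarrow> 's set" where
  "finite_functions U = {f. is_fun f \<and> is_finite (fdom f) \<and> fapp f ` fdom f \<subseteq> U}"

definition tuples :: "'s \<Rightarrow> 's set \<Rightarrow> 's set" where
  "tuples n U = {s. is_fun s \<and> fdom s = elts n \<and> fapp s ` fdom s \<subseteq> U}"

text \<open>
  \<open>generated step x\<close>: there is a (finite, in the sense of the model) formation sequence
  with last entry \<open>x\<close> in which every entry \<open>y\<close> satisfies \<open>step E y\<close>, where \<open>E\<close> is the collection of
  the entries preceding it.  All inductive notions of syntax are introduced in this way, since
  an intersection of all suitably closed classes would need a bound class variable.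
\<close>

definition generated :: "('s set \<Rightarrow> 's \<Rightarrow> bool) \<Rightarrow> 's \<Rightarrow> bool" where
  "generated step x \<longleftrightarrow>
     (\<exists>n s. is_nat n \<and> s \<in> tuples (succ n) UNIV \<and>
        (\<forall>i \<in> elts (succ n). step (fapp s ` elts i) (fapp s i)) \<and> x = fapp s n)"


section \<open>Signatures and syntax\<close>

text \<open>
  A signature is a class function whose value at a symbol is \<open>\<langle>0, n\<rangle>\<close> for an \<open>n\<close>-ary relation
  symbol and \<open>\<langle>1, n\<rangle>\<close> for an \<open>n\<close>-ary operation symbol (a constant if \<open>n = 0\<close>).
\<close>

definition rel_sym :: "'s set \<Rightarrow> 's \<Rightarrow> 's \<Rightarrow> bool" where
  "rel_sym \<rho> R n \<longleftrightarrow> opair R (opair (num 0) n) \<in> \<rho>"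

definition op_sym :: "'s set \<Rightarrow> 's \<Rightarrow> 's \<Rightarrow> bool" where
  "op_sym \<rho> f n \<longleftrightarrow> opair f (opair (num 1) n) \<in> \<rho>"

definition is_signature :: "'s set \<Rightarrow> bool" where
  "is_signature \<rho> \<longleftrightarrow>
     (\<forall>p \<in> \<rho>. \<exists>X k n. p = opair X (opair k n) \<and> k \<in> {num 0, num 1} \<and> is_nat n) \<and>
     (\<forall>X y z. opair X y \<in> \<rho> \<and> opair X z \<in> \<rho> \<longrightarrow> y = z)"

definition var :: "'s \<Rightarrow> 's" where
  "var n = opair (num 0) n"

definition op_term :: "'s \<Rightarrow> 's \<Rightarrow> 's" where
  "op_term f s = opair (num 1) (opair f s)"

definition eq_fm :: "'s \<Rightarrow> 's \<Rightarrow> 's" where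
  "eq_fm t u = opair (num 2) (opair t u)"

definition rel_fm :: "'s \<Rightarrow> 's \<Rightarrow> 's" where
  "rel_fm R s = opair (num 3) (opair R s)"

definition neg_fm :: "'s \<Rightarrow> 's" where
  "neg_fm \<phi> = opair (num 4) \<phi>"

definition conj_fm :: "'s \<Rightarrow> 's \<Rightarrow> 's" where
  "conj_fm \<phi> \<psi> = opair (num 5) (opair \<phi> \<psi>)"

definition ex_fm :: "'s \<Rightarrow> 's \<Rightarrow> 's" where
  "ex_fm v \<phi> = opair (num 6) (opair v \<phi>)"

definition variables :: "'s set" where
  "variables = {var n | n. is_nat n}"

definition "terms" :: "'s set \<Rightarrow> 's set" where
  "terms \<rho> = Collect (generated (\<lambda>E t.
     t \<in> variables \<or>
     (\<exists>f n s. op_sym \<rho> f n \<and> s \<in> tuples n E \<and> t = op_term f s)))"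

definition formulas :: "'s set \<Rightarrow> 's set" where
  "formulas \<rho> = Collect (generated (\<lambda>E \<phi>.
     (\<exists>t \<in> terms \<rho>. \<exists>u \<in> terms \<rho>. \<phi> = eq_fm t u) \<or>
     (\<exists>R n s. rel_sym \<rho> R n \<and> s \<in> tuples n (terms \<rho>) \<and> \<phi> = rel_fm R s) \<or>
     (\<exists>\<psi> \<in> E. \<phi> = neg_fm \<psi>) \<or>
     (\<exists>\<psi> \<in> E. \<exists>\<chi> \<in> E. \<phi> = conj_fm \<psi> \<chi>) \<or>
     (\<exists>v \<in> variables. \<exists>\<psi> \<in> E. \<phi> = ex_fm v \<psi>)))"

definition subformulas :: "'s \<Rightarrow> 's set" where
  "subformulas \<phi> = Collect (generated (\<lambda>E \<psi>.
     \<psi> = \<phi> \<or>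
     (\<exists>\<chi> \<in> E. \<chi> = neg_fm \<psi> \<or> (\<exists>\<theta>. \<chi> = conj_fm \<psi> \<theta> \<or> \<chi> = conj_fm \<theta> \<psi>) \<or>
               (\<exists>v. \<chi> = ex_fm v \<psi>))))"

definition occurs :: "'s \<Rightarrow> 's \<Rightarrow> bool" where
  "occurs v = generated (\<lambda>E t.
     t = v \<or> (\<exists>f s. t = op_term f s \<and> is_fun s \<and> (\<exists>i \<in> fdom s. fapp s i \<in> E)))"

definition occurs_free :: "'s \<Rightarrow> 's \<Rightarrow> bool" where
  "occurs_free v = generated (\<lambda>E \<phi>.
     (\<exists>t u. \<phi> = eq_fm t u \<and> (occurs v t \<or> occurs v u)) \<or>
     (\<exists>R s. \<phi> = rel_fm R s \<and> is_fun s \<and> (\<exists>i \<in> fdom s. occurs v (fapp s i))) \<or>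
     (\<exists>\<psi> \<in> E. \<phi> = neg_fm \<psi>) \<or>
     (\<exists>\<psi> \<chi>. \<phi> = conj_fm \<psi> \<chi> \<and> (\<psi> \<in> E \<or> \<chi> \<in> E)) \<or>
     (\<exists>u. \<exists>\<psi> \<in> E. u \<noteq> v \<and> \<phi> = ex_fm u \<psi>))"

definition free_vars :: "'s \<Rightarrow> 's set" where
  "free_vars \<phi> = {v \<in> variables. occurs_free v \<phi>}"


section \<open>Structures and valuations\<close>

text \<open>
  A structure is coded by a single class \<open>S\<close>, the disjoint union of its universe \<open>|S|\<close> and of the
  denotations \<open>X\<^sup>S\<close> of the symbols \<open>X\<close>:  \<open>\<langle>0, a\<rangle> \<in> S\<close> iff \<open>a \<in> |S|\<close>, and \<open>\<langle>1, \<langle>X, t\<rangle>\<rangle> \<in> S\<close> iff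
  \<open>t \<in> X\<^sup>S\<close>.  The denotation of an operation symbol consists of the pairs \<open>\<langle>arguments, value\<rangle>\<close>.
  An empty universe is not excluded.
\<close>

definition universe :: "'s set \<Rightarrow> 's set" where
  "universe S = {a. opair (num 0) a \<in> S}"

definition denotation :: "'s set \<Rightarrow> 's \<Rightarrow> 's set" where
  "denotation S X = {t. opair (num 1) (opair X t) \<in> S}"

definition is_structure :: "'s set \<Rightarrow> 's set \<Rightarrow> bool" where
  "is_structure \<rho> S \<longleftrightarrow>
     (\<forall>p \<in> S. (\<exists>a. p = opair (num 0) a) \<or>
               (\<exists>X n t. (rel_sym \<rho> X n \<or> op_sym \<rho> X n) \<and> p = opair (num 1) (opair X t))) \<and>
     (\<forall>R n. rel_sym \<rho> R n \<longrightarrow> denotation S R \<subseteq> tuples n (universe S)) \<and>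
     (\<forall>f n. op_sym \<rho> f n \<longrightarrow>
        denotation S f \<subseteq> {opair s a | s a. s \<in> tuples n (universe S) \<and> a \<in> universe S} \<and>
        (\<forall>s \<in> tuples n (universe S). \<exists>!a. opair s a \<in> denotation S f))"

text \<open>\<open>term_value \<rho> S A t a\<close>: the term \<open>t\<close> has value \<open>a\<close> in \<open>S\<close> at the assignment \<open>A\<close>.\<close>

definition term_value :: "'s set \<Rightarrow> 's set \<Rightarrow> 's \<Rightarrow> 's \<Rightarrow> 's \<Rightarrow> bool" where
  "term_value \<rho> S A t a \<longleftrightarrow> generated (\<lambda>E p.
     (\<exists>v \<in> variables. \<exists>b. p = opair v b \<and> opair v b \<in> elts A) \<or>
     (\<exists>f n s w b. p = opair (op_term f s) b \<and> op_sym \<rho> f n \<and>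
        s \<in> tuples n UNIV \<and> w \<in> tuples n UNIV \<and>
        (\<forall>i \<in> elts n. opair (fapp s i) (fapp w i) \<in> E) \<and>
        opair w b \<in> denotation S f)) (opair t a)"

definition evaluable :: "'s set \<Rightarrow> 's set \<Rightarrow> 's \<Rightarrow> 's \<Rightarrow> bool" where
  "evaluable S \<Phi> \<phi> A \<longleftrightarrow>
     (\<exists>\<chi> \<in> \<Phi>. \<phi> \<in> subformulas \<chi>) \<and> A \<in> finite_functions (universe S) \<and> free_vars \<phi> \<subseteq> fdom A"

text \<open>
  A valuation is a class function from the evaluable pairs \<open>\<langle>\<phi>, A\<rangle>\<close> to the truth values \<open>0\<close>, \<open>1\<close>
  obeying Tarski's clauses.
\<close>

definition is_true :: "'s set \<Rightarrow> 's \<Rightarrow> 's \<Rightarrow> bool" where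
  "is_true V \<phi> A \<longleftrightarrow> opair (opair \<phi> A) (num 1) \<in> V"

definition tarski_clauses :: "'s set \<Rightarrow> 's set \<Rightarrow> 's set \<Rightarrow> 's set \<Rightarrow> bool" where
  "tarski_clauses \<rho> S \<Phi> V \<longleftrightarrow>
     (\<forall>t u A. evaluable S \<Phi> (eq_fm t u) A \<longrightarrow>
        (is_true V (eq_fm t u) A \<longleftrightarrow> (\<exists>a. term_value \<rho> S A t a \<and> term_value \<rho> S A u a))) \<and>
     (\<forall>R s A. evaluable S \<Phi> (rel_fm R s) A \<longrightarrow>
        (is_true V (rel_fm R s) A \<longleftrightarrow>
           (\<exists>w \<in> denotation S R. fdom w = fdom s \<and>
              (\<forall>i \<in> fdom s. term_value \<rho> S A (fapp s i) (fapp w i))))) \<and>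
     (\<forall>\<psi> A. evaluable S \<Phi> (neg_fm \<psi>) A \<longrightarrow>
        (is_true V (neg_fm \<psi>) A \<longleftrightarrow> \<not> is_true V \<psi> A)) \<and>
     (\<forall>\<psi> \<chi> A. evaluable S \<Phi> (conj_fm \<psi> \<chi>) A \<longrightarrow>
        (is_true V (conj_fm \<psi> \<chi>) A \<longleftrightarrow> is_true V \<psi> A \<and> is_true V \<chi> A)) \<and>
     (\<forall>v \<psi> A. evaluable S \<Phi> (ex_fm v \<psi>) A \<longrightarrow>
        (is_true V (ex_fm v \<psi>) A \<longleftrightarrow> (\<exists>a \<in> universe S. is_true V \<psi> (fupd A v a))))"

definition is_valuation :: "'s set \<Rightarrow> 's set \<Rightarrow> 's set \<Rightarrow> 's set \<Rightarrow> bool" where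
  "is_valuation \<rho> S \<Phi> V \<longleftrightarrow>
     (\<forall>p \<in> V. \<exists>\<phi> A e. p = opair (opair \<phi> A) e \<and> evaluable S \<Phi> \<phi> A \<and> e \<in> {num 0, num 1}) \<and>
     (\<forall>\<phi> A. evaluable S \<Phi> \<phi> A \<longrightarrow> (\<exists>!e. opair (opair \<phi> A) e \<in> V)) \<and>
     tarski_clauses \<rho> S \<Phi> V"

end


section \<open>Goedel--Bernays class theory without Infinity\<close>

text \<open>
  There is no axiom of choice.  Existence of the empty set is listed because it is usually
  derived from Infinity; \<open>Cls \<noteq> {}\<close> says that the sort of classes is nonempty.
\<close>

locale GB_without_Infinity = set_universe elts
  for elts :: "'s \<Rightarrow> 's set" +
  fixes Cls :: "'s set set"
  assumes extensionality: "elts x = elts y \<Longrightarrow> x = y"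
    and classes_exist: "Cls \<noteq> {}"
    and class_comprehension:
      "range C \<subseteq> Cls \<Longrightarrow> {a. holds elts C (env(0 := a)) \<phi>} \<in> Cls"
    and empty_set: "is_set {}"
    and pairing: "is_set {x, y}"
    and union: "is_set (\<Union>y \<in> elts x. elts y)"
    and power_set: "is_set {y. elts y \<subseteq> elts x}"
    and replacement:
      "\<lbrakk>F \<in> Cls; \<And>x y z. \<lbrakk>opair x y \<in> F; opair x z \<in> F\<rbrakk> \<Longrightarrow> y = z\<rbrakk>
         \<Longrightarrow> is_set {y. \<exists>x \<in> elts a. opair x y \<in> F}"
    and foundation: "\<lbrakk>X \<in> Cls; X \<noteq> {}\<rbrakk> \<Longrightarrow> \<exists>x \<in> X. elts x \<inter> X = {}"
begin

definition is_satisfaction_relation :: "'s set \<Rightarrow> 's set \<Rightarrow> 's set \<Rightarrow> 's set \<Rightarrow> bool" where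
  "is_satisfaction_relation \<rho> S \<Phi> T \<longleftrightarrow>
     \<Phi> \<in> Cls \<and> \<Phi> \<subseteq> formulas \<rho> \<and> T \<in> Cls \<and>
     (\<exists>V \<in> Cls. is_valuation \<rho> S \<Phi> V \<and>
        T = {opair \<phi> A | \<phi> A. evaluable S \<Phi> \<phi> A \<and> is_true V \<phi> A})"

definition satisfactory :: "'s set \<Rightarrow> 's set \<Rightarrow> bool" where
  "satisfactory \<rho> S \<longleftrightarrow> (\<exists>T. is_satisfaction_relation \<rho> S (formulas \<rho>) T)"

end

end

theory Submission
  imports Defs
begin

text \<open>
  The truth value of \<open>\<phi>\<close> at \<open>A\<close> depends, by Tarski's clauses, only on truth values of immediate
  subformulas of \<open>\<phi>\<close>; since \<open>|S|\<close> is a set, these are set-many. So for every \<open>\<phi>\<close> and every set of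
  assignments there is a \<^emph>\<open>set\<close> which is a partial valuation, is closed under these dependencies, and
  decides \<open>\<phi>\<close> at the given assignments: this is an induction on \<open>\<phi>\<close> for a formula without bound
  class variables. Any two such sets agree, and their union, restricted to the evaluable pairs, is
  the required class.

  Both inductions on \<open>\<phi>\<close> are instances of \<open>\<in>\<close>-induction, because a formula belongs to the transitive
  closure of its superformulas. They do not mention formation sequences and work for arbitrary sets
  \<open>\<phi>\<close> and \<open>A\<close>.
\<close>

section \<open>Definability\<close>

text \<open>\<open>r\<close> moves set variables, bound ones included, and \<open>q\<close> moves
  class variables. The second map makes it possible to combine the class parameters of two
  formulas.\<close>

primrec rename :: "(nat \<Rightarrow> nat) \<Rightarrow> (nat \<Rightarrow> nat) \<Rightarrow> cform \<Rightarrow> cform" where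
  "rename r q (InSet i j) = InSet (r i) (r j)"
| "rename r q (EqSet i j) = EqSet (r i) (r j)"
| "rename r q (InClass i j) = InClass (r i) (q j)"
| "rename r q (Neg \<phi>) = Neg (rename r q \<phi>)"
| "rename r q (Conj \<phi> \<psi>) = Conj (rename r q \<phi>) (rename r q \<psi>)"
| "rename r q (ExSet i \<phi>) = ExSet (r i) (rename r q \<phi>)"

primrec set_vars :: "cform \<Rightarrow> nat set" where
  "set_vars (InSet i j) = {i, j}"
| "set_vars (EqSet i j) = {i, j}"
| "set_vars (InClass i j) = {i}"
| "set_vars (Neg \<phi>) = set_vars \<phi>"
| "set_vars (Conj \<phi> \<psi>) = set_vars \<phi> \<union> set_vars \<psi>"
| "set_vars (ExSet i \<phi>) = insert i (set_vars \<phi>)"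

lemma finite_set_vars: "finite (set_vars \<phi>)"
  by (induction \<phi>) auto

text \<open>Injectivity on bound and free variables alike prevents capture: updating the environment
  at \<open>r i\<close> leaves the values at all other \<open>r j\<close> intact.\<close>

lemma holds_rename:
  assumes "inj_on r (set_vars \<phi>)" and "\<And>i. i \<in> set_vars \<phi> \<Longrightarrow> x (r i) = y i" and "\<And>k. C (q k) = D k"
  shows "holds elts C x (rename r q \<phi>) \<longleftrightarrow> holds elts D y \<phi>"
  using assms(1,2)
proof (induction \<phi> arbitrary: x y)
  case (Conj \<phi> \<psi>)
  then show ?case by (auto simp: inj_on_Un)
next
  case (ExSet i \<phi>)
  have "holds elts C (x(r i := a)) (rename r q \<phi>) \<longleftrightarrow> holds elts D (y(i := a)) \<phi>" for a
  proof (rule ExSet.IH)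
    show "inj_on r (set_vars \<phi>)" using ExSet.prems by auto
    show "(x(r i := a)) (r j) = (y(i := a)) j" if "j \<in> set_vars \<phi>" for j
      using that ExSet.prems by (auto simp: inj_on_def)
  qed
  then show ?case by simp
qed (use assms(3) in auto)

context GB_without_Infinity
begin

text \<open>One formula and one choice of class parameters serve all environments. Set parameters
  are ordinary variables here; constants enter later through singleton classes.\<close>

definition definable :: "((nat \<Rightarrow> 's) \<Rightarrow> bool) \<Rightarrow> bool" where
  "definable P \<longleftrightarrow> (\<exists>C \<phi>. range C \<subseteq> Cls \<and> (\<forall>x. P x \<longleftrightarrow> holds elts C x \<phi>))"

text \<open>
  Free variables are numbered as de Bruijn indices: a binder occupies index \<open>0\<close> and shifts the
  environment. Thus the rules below have higher-order patterns as conclusions, and \<open>intro\<close> can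
  apply them without any explicit choice of variables.
\<close>

definition definable_term :: "((nat \<Rightarrow> 's) \<Rightarrow> 's) \<Rightarrow> bool" where
  "definable_term t \<longleftrightarrow> definable (\<lambda>x. x 0 = t (\<lambda>n. x (Suc n)))"

definition definable_class :: "((nat \<Rightarrow> 's) \<Rightarrow> 's set) \<Rightarrow> bool" where
  "definable_class K \<longleftrightarrow> definable (\<lambda>x. x 0 \<in> K (\<lambda>n. x (Suc n)))"

named_theorems definable_intros

section \<open>Closure of definable predicates under connectives and quantifiers\<close>

lemma definable_rename:
  assumes "definable P" and "inj r"
  shows "definable (\<lambda>x. P (\<lambda>n. x (r n)))"
proof -
  obtain C \<phi> where *: "range C \<subseteq> Cls" "\<And>x. P x \<longleftrightarrow> holds elts C x \<phi>"
    using assms(1) unfolding definable_def by auto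
  have "P (\<lambda>n. x (r n)) \<longleftrightarrow> holds elts C x (rename r id \<phi>)" for x
    using holds_rename[of r \<phi> x "\<lambda>n. x (r n)" C id C elts] assms(2) *(2)
    by (auto intro: inj_on_subset)
  then show ?thesis using *(1) unfolding definable_def by blast
qed

lemma definable_holds: "range C \<subseteq> Cls \<Longrightarrow> definable (\<lambda>x. holds elts C x \<phi>)"
  unfolding definable_def by blast

text \<open>A formula without class variables still has to be given a class environment.\<close>

lemma const_range: "\<exists>C::nat \<Rightarrow> 's set. range C \<subseteq> Cls"
  using classes_exist by (auto intro!: exI[of _ "\<lambda>_. SOME X. X \<in> Cls"] some_in_eq[THEN iffD2])

lemma definable_mem_var: "definable (\<lambda>x. x i \<in> elts (x j))"
  using definable_holds[of _ "InSet i j"] const_range by auto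

lemma definable_eq_var: "definable (\<lambda>x. x i = x j)"
  using definable_holds[of _ "EqSet i j"] const_range by auto

lemma definable_class_var: "X \<in> Cls \<Longrightarrow> definable (\<lambda>x. x i \<in> X)"
  using definable_holds[of "\<lambda>_. X" "InClass i 0"] by auto

lemma definable_not [definable_intros]:
  assumes "definable P"
  shows "definable (\<lambda>x. \<not> P x)"
proof -
  obtain C \<phi> where "range C \<subseteq> Cls" "\<And>x. P x \<longleftrightarrow> holds elts C x \<phi>"
    using assms unfolding definable_def by auto
  then show ?thesis using definable_holds[of C "Neg \<phi>"] by simp
qed

lemma definable_conj [definable_intros]:
  assumes "definable P" and "definable Q"
  shows "definable (\<lambda>x. P x \<and> Q x)"
proof -
  obtain C \<phi> D \<psi> where C: "range C \<subseteq> Cls" "\<And>x. P x \<longleftrightarrow> holds elts C x \<phi>"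
    and D: "range D \<subseteq> Cls" "\<And>x. Q x \<longleftrightarrow> holds elts D x \<psi>"
    using assms unfolding definable_def by auto
  \<comment> \<open>Even class variables carry the parameters of the first formula, odd ones those
    of the second.\<close>
  define B where "B n = (if even n then C (n div 2) else D (n div 2))" for n
  have "range B \<subseteq> Cls" using C(1) D(1) by (auto simp: B_def)
  moreover have "P x \<and> Q x \<longleftrightarrow>
      holds elts B x (Conj (rename id (\<lambda>k. 2 * k) \<phi>) (rename id (\<lambda>k. Suc (2 * k)) \<psi>))" for x
    using holds_rename[of id \<phi> x x B "\<lambda>k. 2 * k" C elts] C(2)
      holds_rename[of id \<psi> x x B "\<lambda>k. Suc (2 * k)" D elts] D(2)
    by (simp add: B_def)
  ultimately show ?thesis unfolding definable_def by blast
qed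

lemma definable_ex [definable_intros]:
  assumes "definable (\<lambda>x. P (x 0) (\<lambda>n. x (Suc n)))"
  shows "definable (\<lambda>x. \<exists>a. P a x)"
proof -
  obtain C \<phi> where C: "range C \<subseteq> Cls" "\<And>x. P (x 0) (\<lambda>n. x (Suc n)) \<longleftrightarrow> holds elts C x \<phi>"
    using assms unfolding definable_def by auto
  obtain N where N: "\<And>i. i \<in> set_vars \<phi> \<Longrightarrow> i < N"
    using finite_set_vars[of \<phi>] finite_nat_set_iff_bounded by auto
  \<comment> \<open>The bound variable 0 moves to the fresh index \<open>N\<close> and every other
    index drops by one. All shifted indices stay below \<open>N\<close>, so nothing clashes.\<close>
  define r where "r = case_nat N id"
  have "P a x \<longleftrightarrow> holds elts C (x(N := a)) (rename r id \<phi>)" for a x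
  proof -
    have "inj_on r (set_vars \<phi>)"
      by (auto simp: inj_on_def r_def split: nat.splits dest!: N)
    moreover have "(x(N := a)) (r i) = case_nat a x i" if "i \<in> set_vars \<phi>" for i
      using N[OF that] by (auto simp: r_def split: nat.splits)
    ultimately show ?thesis
      using holds_rename[of r \<phi> "x(N := a)" "case_nat a x" C id C elts] C(2)[of "case_nat a x"]
      by simp
  qed
  then show ?thesis
    using definable_holds[OF C(1), of "ExSet N (rename r id \<phi>)"] by simp
qed

lemma definable_disj [definable_intros]:
  "definable P \<Longrightarrow> definable Q \<Longrightarrow> definable (\<lambda>x. P x \<or> Q x)"
  by (rule definable_not[OF definable_conj[OF definable_not definable_not], of P Q, simplified])

lemma definable_imp [definable_intros]:
  "definable P \<Longrightarrow> definable Q \<Longrightarrow> definable (\<lambda>x. P x \<longrightarrow> Q x)"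
  unfolding imp_conv_disj by (intro definable_disj definable_not)

lemma definable_iff [definable_intros]:
  "definable P \<Longrightarrow> definable Q \<Longrightarrow> definable (\<lambda>x. P x \<longleftrightarrow> Q x)"
  unfolding iff_conv_conj_imp by (intro definable_conj definable_imp)

lemma definable_all [definable_intros]:
  assumes "definable (\<lambda>x. P (x 0) (\<lambda>n. x (Suc n)))"
  shows "definable (\<lambda>x. \<forall>a. P a x)"
  using definable_not[OF definable_ex[OF definable_not], OF assms] by simp

section \<open>Substitution of definable terms\<close>

lemma inj_shift_under: "inj (case_nat 0 (\<lambda>n. Suc (Suc n)))"
  by (auto simp: inj_def split: nat.splits)

lemma definable_shift: "definable P \<Longrightarrow> definable (\<lambda>x. P (\<lambda>n. x (Suc n)))"
  by (rule definable_rename) auto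

text \<open>Index 0 holds the value of the term, so the new variable is inserted at index 1.\<close>

lemma definable_term_shift:
  assumes "definable_term t"
  shows "definable_term (\<lambda>x. t (\<lambda>n. x (Suc n)))"
  using definable_rename[OF _ inj_shift_under, of "\<lambda>x. x 0 = t (\<lambda>n. x (Suc n))"] assms
  unfolding definable_term_def by simp

lemma definable_class_shift:
  assumes "definable_class K"
  shows "definable_class (\<lambda>x. K (\<lambda>n. x (Suc n)))"
  using definable_rename[OF _ inj_shift_under, of "\<lambda>x. x 0 \<in> K (\<lambda>n. x (Suc n))"] assms
  unfolding definable_class_def by simp

text \<open>A term with definable graph is eliminated by an existential quantifier over its
  value.\<close>

lemma definable_subst:
  assumes "definable_term t" and "definable (\<lambda>x. P (x 0) (\<lambda>n. x (Suc n)))"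
  shows "definable (\<lambda>x. P (t x) x)"
  using definable_ex[of "\<lambda>a x. a = t x \<and> P a x", OF definable_conj] assms
  unfolding definable_term_def by simp

text \<open>The arguments are replaced one at a time; while the last one is held by a variable, the
  terms still to be substituted live in a shifted environment.\<close>

lemma definable_subst2:
  assumes "definable (\<lambda>x. R (x 0) (x 1))" and "definable_term s" and "definable_term t"
  shows "definable (\<lambda>x. R (s x) (t x))"
proof (rule definable_subst[OF assms(3)])
  show "definable (\<lambda>x. R (s (\<lambda>n. x (Suc n))) (x 0))"
    by (rule definable_subst[OF definable_term_shift[OF assms(2)]]) (use assms(1) in simp)
qed

lemma definable_subst3:
  assumes "definable (\<lambda>x. R (x 0) (x 1) (x 2))"
    and "definable_term s" and "definable_term t" and "definable_term u"
  shows "definable (\<lambda>x. R (s x) (t x) (u x))"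
proof (rule definable_subst[OF assms(4)])
  show "definable (\<lambda>x. R (s (\<lambda>n. x (Suc n))) (t (\<lambda>n. x (Suc n))) (x 0))"
  proof (rule definable_subst[OF definable_term_shift[OF assms(3)]])
    show "definable (\<lambda>x. R (s (\<lambda>n. x (Suc (Suc n)))) (x 0) (x (Suc 0)))"
      by (rule definable_subst[OF definable_term_shift[OF definable_term_shift[OF assms(2)]]])
         (use assms(1) in \<open>simp add: numeral_2_eq_2\<close>)
  qed
qed

lemma definable_subst1:
  assumes "definable (\<lambda>x. R (x 0))" and "definable_term s"
  shows "definable (\<lambda>x. R (s x))"
  by (rule definable_subst) (use assms in auto)

lemma definable_var [definable_intros]: "definable_term (\<lambda>x. x i)"
  unfolding definable_term_def by (rule definable_eq_var)

lemma definable_eq [definable_intros]: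
  "definable_term s \<Longrightarrow> definable_term t \<Longrightarrow> definable (\<lambda>x. s x = t x)"
  by (rule definable_subst2[of "(=)"]) (rule definable_eq_var)

lemma definable_mem [definable_intros]:
  "definable_term t \<Longrightarrow> definable_class K \<Longrightarrow> definable (\<lambda>x. t x \<in> K x)"
  by (rule definable_subst) (simp_all add: definable_class_def)

lemma definable_elts [definable_intros]:
  "definable_term t \<Longrightarrow> definable_class (\<lambda>x. elts (t x))"
  unfolding definable_class_def
  by (rule definable_subst2[of "\<lambda>a b. a \<in> elts b"])
     (rule definable_mem_var definable_var definable_term_shift, assumption?)+

lemma definable_class_const [definable_intros]:
  "X \<in> Cls \<Longrightarrow> definable_class (\<lambda>x. X)"
  unfolding definable_class_def by (rule definable_class_var)

lemma definable_Collect [definable_intros]: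
  "definable (\<lambda>x. P (x 0) (\<lambda>n. x (Suc n))) \<Longrightarrow> definable_class (\<lambda>x. {a. P a x})"
  unfolding definable_class_def by simp

lemma definable_ball [definable_intros]:
  "definable_class K \<Longrightarrow> definable (\<lambda>x. P (x 0) (\<lambda>n. x (Suc n))) \<Longrightarrow> definable (\<lambda>x. \<forall>a\<in>K x. P a x)"
  unfolding Ball_def definable_class_def by (intro definable_all definable_imp)

lemma definable_bex [definable_intros]:
  "definable_class K \<Longrightarrow> definable (\<lambda>x. P (x 0) (\<lambda>n. x (Suc n))) \<Longrightarrow> definable (\<lambda>x. \<exists>a\<in>K x. P a x)"
  unfolding Bex_def definable_class_def by (intro definable_ex definable_conj)

lemma definable_subset [definable_intros]:
  "definable_class K \<Longrightarrow> definable_class L \<Longrightarrow> definable (\<lambda>x. K x \<subseteq> L x)"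
  unfolding subset_eq
  by (intro definable_ball) (simp_all add: definable_class_def)

lemma definable_set_eq [definable_intros]:
  "definable_class K \<Longrightarrow> definable_class L \<Longrightarrow> definable (\<lambda>x. K x = L x)"
  unfolding set_eq_subset by (intro definable_intros)

lemma definable_insert [definable_intros]:
  assumes "definable_term t" and "definable_class K"
  shows "definable_class (\<lambda>x. insert (t x) (K x))"
  using definable_disj assms unfolding definable_class_def definable_term_def by simp

lemma definable_empty [definable_intros]: "definable_class (\<lambda>x. {})"
  unfolding definable_class_def
  using definable_not[OF definable_eq_var[of 0 0]] by simp

section \<open>Classes and constants from definable predicates\<close>

lemma class_of_definable:
  "definable (\<lambda>x. P (x 0)) \<Longrightarrow> {a. P a} \<in> Cls"
proof -
  assume "definable (\<lambda>x. P (x 0))"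
  then obtain C \<phi> where C: "range C \<subseteq> Cls" "\<And>x. P (x 0) \<longleftrightarrow> holds elts C x \<phi>"
    unfolding definable_def by auto
  \<comment> \<open>Only index 0 is read, so an arbitrary environment \<open>x\<close> can supply
    the other values.\<close>
  have "{a. P a} = {a. holds elts C (x(0 := a)) \<phi>}" for x
    using C(2)[of "x(0 := _)"] by simp
  then show ?thesis using class_comprehension[OF C(1)] by metis
qed

text \<open>The parameter \<open>c\<close> is the value of variable 1. With this, any set can be
  used as a parameter inside a definable predicate.\<close>

lemma class_singleton: "{c} \<in> Cls"
  using const_range class_comprehension[of _ "\<lambda>_. c" "EqSet 0 1"] by auto

lemma definable_const [definable_intros]: "definable_term (\<lambda>x. c)"
  unfolding definable_term_def using definable_class_var[OF class_singleton[of c], of 0] by simp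

section \<open>Sets, functions and finiteness\<close>

lemma elts_set_of: "is_set X \<Longrightarrow> elts (set_of X) = X"
  unfolding is_set_def set_of_def by (metis (mono_tags, lifting) extensionality theI_unique)

lemma set_of_elts [simp]: "set_of (elts x) = x"
  unfolding set_of_def by (auto intro: extensionality)

lemma is_set_elts [simp]: "is_set (elts x)"
  by (auto simp: is_set_def)

text \<open>When \<open>K\<close> has set values, the graph of \<open>set_of\<close> is the
  condition \<open>elts y = K x\<close>, which is free of the description operator.\<close>

lemma definable_set_of:
  assumes "\<And>x. is_set (K x)" and "definable_class K"
  shows "definable_term (\<lambda>x. set_of (K x))"
proof -
  have "y = set_of (K x) \<longleftrightarrow> elts y = K x" for x y
    using assms(1) elts_set_of set_of_elts by metis
  moreover have "definable (\<lambda>x. elts (x 0) = K (\<lambda>n. x (Suc n)))"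
    by (intro definable_intros definable_class_shift assms)
  ultimately show ?thesis unfolding definable_term_def by simp
qed

text \<open>Kuratowski pairs: extensionality reduces the claim to equality of doubletons, a
  singleton being read as a doubleton.\<close>

lemma opair_inject [simp]: "opair a b = opair c d \<longleftrightarrow> a = c \<and> b = d"
proof -
  have *: "set_of {x, y} = set_of {u, v} \<longleftrightarrow> {x, y} = {u, v}" for x y u v
    using elts_set_of[OF pairing] by metis
  have "set_of {x} = set_of {x, x}" for x by simp
  then show ?thesis unfolding opair_def by (metis * doubleton_eq_iff)
qed

lemma definable_opair [definable_intros]:
  "definable_term s \<Longrightarrow> definable_term t \<Longrightarrow> definable_term (\<lambda>x. opair (s x) (t x))"
  unfolding opair_def using pairing[of a a for a]
  by (intro definable_set_of definable_intros) (simp_all add: pairing)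

text \<open>Replacement for a definable graph. \<open>R\<close> may be undefined at some members of
  \<open>a\<close>, which covers separation and projections of pairs.\<close>

lemma is_set_partial_image:
  assumes "definable (\<lambda>x. R (x 0) (x 1))" and "\<And>x y z. R x y \<Longrightarrow> R x z \<Longrightarrow> y = z"
  shows "is_set {y. \<exists>x \<in> elts a. R x y}"
proof -
  have "{p. \<exists>x y. p = opair x y \<and> R x y} \<in> Cls"
    by (rule class_of_definable) (intro definable_intros definable_subst2[OF assms(1)])
  from replacement[OF this] assms(2) show ?thesis by auto
qed

lemma is_set_image:
  assumes "definable_term (\<lambda>x. F (x 0))"
  shows "is_set (F ` elts a)"
proof -
  have "definable_term (\<lambda>x. F (x 1))"
    using definable_term_shift[OF assms] by simp
  then have "definable (\<lambda>x. x 1 = F (x 0))"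
    by (intro definable_intros assms)
  from is_set_partial_image[OF this] show ?thesis by (simp add: image_def)
qed

text \<open>Replacement along the identity restricted to \<open>P\<close>.\<close>

lemma is_set_separation:
  assumes "definable (\<lambda>x. P (x 0))"
  shows "is_set {y \<in> elts a. P y}"
proof -
  have "is_set {y. \<exists>x \<in> elts a. x = y \<and> P x}"
    by (rule is_set_partial_image) (auto intro!: definable_intros assms)
  moreover have "{y. \<exists>x \<in> elts a. x = y \<and> P x} = {y \<in> elts a. P y}" by auto
  ultimately show ?thesis by simp
qed

lemma is_set_Un:
  assumes "is_set X" and "is_set Y"
  shows "is_set (X \<union> Y)"
  using union[of "set_of {set_of X, set_of Y}"] by (simp add: elts_set_of pairing assms)

lemma is_set_insert:
  assumes "is_set X"
  shows "is_set (insert a X)"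
  using is_set_Un[OF pairing[of a a] assms] by simp

lemma is_set_Union: "is_set X \<Longrightarrow> is_set (\<Union>y\<in>X. elts y)"
  using union[of "set_of X"] by (simp add: elts_set_of)

lemma elts_succ [simp]: "elts (succ x) = insert x (elts x)"
  by (simp add: succ_def elts_set_of is_set_insert)

lemma elts_zero [simp]: "elts zero = {}"
  by (simp add: zero_def elts_set_of empty_set)

lemma definable_succ [definable_intros]:
  "definable_term t \<Longrightarrow> definable_term (\<lambda>x. succ (t x))"
  unfolding succ_def by (intro definable_set_of definable_intros) (simp_all add: is_set_insert)

lemma elts_fupd: "elts (fupd f x a) = insert (opair x a) {p \<in> elts f. \<not> (\<exists>y. p = opair x y)}"
  unfolding fupd_def by (intro elts_set_of is_set_insert is_set_separation definable_intros)

lemma definable_fupd [definable_intros]: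
  assumes "definable_term s" "definable_term t" "definable_term u"
  shows "definable_term (\<lambda>x. fupd (s x) (t x) (u x))"
  unfolding fupd_def
  by (intro definable_set_of is_set_insert is_set_separation definable_intros assms
      assms[THEN definable_term_shift] assms[THEN definable_term_shift, THEN definable_term_shift])

text \<open>
  Function application as a total definable operation: it agrees with \<open>fapp\<close> on the domain of a
  function, whereas the unspecified values of \<open>fapp\<close> elsewhere need not be definable.
\<close>

definition app :: "'s \<Rightarrow> 's \<Rightarrow> 's" where
  "app f x = set_of (\<Union>y\<in>{y. opair x y \<in> elts f}. elts y)"

lemma definable_UN_elts [definable_intros]:
  assumes "definable_class K"
  shows "definable_class (\<lambda>x. \<Union>y\<in>K x. elts y)"
proof -
  have "(\<Union>y\<in>K x. elts y) = {a. \<exists>y\<in>K x. a \<in> elts y}" for x by auto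
  then show ?thesis
    using assms by (auto intro!: definable_intros definable_class_shift)
qed

lemma definable_app [definable_intros]:
  assumes "definable_term s" "definable_term t"
  shows "definable_term (\<lambda>x. app (s x) (t x))"
  unfolding app_def
proof (rule definable_set_of)
  fix x
  \<comment> \<open>The values at \<open>t x\<close> are a partial image of \<open>s x\<close>:
    project the pairs with first component \<open>t x\<close>. This holds for every set, so
    \<open>app\<close> is total.\<close>
  have "is_set {y. \<exists>p \<in> elts (s x). p = opair (t x) y}"
    by (rule is_set_partial_image) (auto intro!: definable_intros)
  moreover have "{y. \<exists>p \<in> elts (s x). p = opair (t x) y} = {y. opair (t x) y \<in> elts (s x)}" by auto
  ultimately show "is_set (\<Union>y\<in>{y. opair (t x) y \<in> elts (s x)}. elts y)"
    using is_set_Union by simp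
next
  show "definable_class (\<lambda>x. \<Union>y\<in>{y. opair (t x) y \<in> elts (s x)}. elts y)"
    by (intro definable_intros assms[THEN definable_term_shift])
qed

lemma definable_class_subst:
  "definable_class (\<lambda>x. K (x 0)) \<Longrightarrow> definable_term t \<Longrightarrow> definable_class (\<lambda>x. K (t x))"
  unfolding definable_class_def
  by (rule definable_subst2[of "\<lambda>a b. a \<in> K b"], simp) (rule definable_var definable_term_shift, assumption?)+

lemma definable_UNIV [definable_intros]: "definable_class (\<lambda>x. UNIV)"
  unfolding definable_class_def using definable_eq_var[of 0 0] by simp

text \<open>Foundation holds for classes, so it yields a minimal counterexample directly;
  definability of \<open>P\<close> makes the counterexamples a class.\<close>

lemma elts_induct:
  assumes "definable (\<lambda>x. P (x 0))" and "\<And>x. (\<And>y. y \<in> elts x \<Longrightarrow> P y) \<Longrightarrow> P x"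
  shows "P a"
proof (rule ccontr)
  assume "\<not> P a"
  have "{x. \<not> P x} \<in> Cls"
    by (rule class_of_definable) (intro definable_intros assms)
  from foundation[OF this] \<open>\<not> P a\<close> obtain x where "\<not> P x" "elts x \<inter> {x. \<not> P x} = {}" by auto
  with assms(2)[of x] show False by auto
qed

lemma elts_irrefl [simp]: "x \<notin> elts x"
  using foundation[OF class_singleton[of x]] by auto

text \<open>Induction over external numbers. Together with irreflexivity of membership this
  separates the tags used in the coding of syntax.\<close>

lemma num_mem: "i < j \<Longrightarrow> num i \<in> elts (num j)"
  by (induction j) (auto simp: less_Suc_eq)

declare num.simps [simp del]

lemma num_eq_iff [simp]: "num i = num j \<longleftrightarrow> i = j"
  by (metis elts_irrefl linorder_neqE_nat num_mem)

lemma is_nat_succ: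
  assumes "is_nat n"
  shows "is_nat (succ n)"
  using assms unfolding is_nat_def elts_succ by blast

lemma elts_subset_of_is_nat: "is_nat n \<Longrightarrow> i \<in> elts n \<Longrightarrow> elts i \<subseteq> elts n"
  unfolding is_nat_def by blast

lemma definable_is_nat [definable_intros]:
  assumes "definable_term t"
  shows "definable (\<lambda>x. is_nat (t x))"
  by (rule definable_subst1[OF _ assms]) (unfold is_nat_def, intro definable_intros)

lemma definable_is_fun [definable_intros]:
  assumes "definable_term t"
  shows "definable (\<lambda>x. is_fun (t x))"
  by (rule definable_subst1[OF _ assms]) (unfold is_fun_def, intro definable_intros)

lemma definable_fdom [definable_intros]:
  assumes "definable_term t"
  shows "definable_class (\<lambda>x. fdom (t x))"
  by (rule definable_class_subst[OF _ assms]) (unfold fdom_def, intro definable_intros)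

lemma app_eqI: "is_fun f \<Longrightarrow> opair x y \<in> elts f \<Longrightarrow> app f x = y"
proof -
  assume "is_fun f" "opair x y \<in> elts f"
  then have "{y. opair x y \<in> elts f} = {y}" unfolding is_fun_def by blast
  then show ?thesis by (simp add: app_def)
qed

lemma fapp_eqI: "is_fun f \<Longrightarrow> opair x y \<in> elts f \<Longrightarrow> fapp f x = y"
  unfolding is_fun_def fapp_def by blast

lemma fapp_eq_app: "is_fun f \<Longrightarrow> x \<in> fdom f \<Longrightarrow> fapp f x = app f x"
  by (auto simp: fdom_def app_eqI fapp_eqI)

lemma is_fun_fupd: "is_fun f \<Longrightarrow> is_fun (fupd f x a)"
  unfolding is_fun_def elts_fupd by auto

lemma fdom_fupd [simp]: "fdom (fupd f x a) = insert x (fdom f)"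
  unfolding fdom_def elts_fupd by auto

lemma app_fupd [simp]: "app (fupd f x a) y = (if y = x then a else app f y)"
proof -
  have "{b. opair y b \<in> elts (fupd f x a)} = (if y = x then {a} else {b. opair y b \<in> elts f})"
    unfolding elts_fupd by auto
  then show ?thesis by (simp add: app_def)
qed

lemma definable_image_app [definable_intros]:
  assumes "definable_term t" and "definable_class K"
  shows "definable_class (\<lambda>x. app (t x) ` K x)"
  unfolding image_def
  by (intro definable_intros assms definable_class_shift
      definable_term_shift[OF assms(1)] definable_term_shift[OF definable_term_shift[OF assms(1)]])

text \<open>Rewrites the notion with \<open>app\<close>, whose graph is definable;
  \<open>app\<close> and \<open>fapp\<close> agree on the domain of a function. The later equations
  of this kind serve the same end.\<close>

lemma tuples_eq: "tuples n U = {s. is_fun s \<and> fdom s = elts n \<and> app s ` elts n \<subseteq> U}"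
  unfolding tuples_def by (auto simp: fapp_eq_app)

lemma definable_tuples [definable_intros]:
  assumes "definable_term n" and "definable_class K"
  shows "definable_class (\<lambda>x. tuples (n x) (K x))"
  unfolding tuples_eq
  by (intro definable_intros definable_class_shift assms definable_term_shift[OF assms(1)])

lemma finite_functions_eq:
  "finite_functions U = {f. is_fun f \<and> is_finite (fdom f) \<and> app f ` fdom f \<subseteq> U}"
  unfolding finite_functions_def by (auto simp: fapp_eq_app)

lemma is_finite_iff:
  "is_finite X \<longleftrightarrow>
    (\<exists>n g. is_nat n \<and> is_fun g \<and> fdom g = elts n \<and> bij_betw (app g) (elts n) X)"
  unfolding is_finite_def by (metis bij_betw_cong fapp_eq_app)

lemma definable_is_finite [definable_intros]:
  assumes "definable_class K"
  shows "definable (\<lambda>x. is_finite (K x))"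
  unfolding is_finite_iff bij_betw_def inj_on_def
  by (intro definable_intros definable_class_shift assms)

lemma definable_finite_functions [definable_intros]:
  assumes "definable_class K"
  shows "definable_class (\<lambda>x. finite_functions (K x))"
  unfolding finite_functions_eq
  by (intro definable_intros definable_class_shift assms)

lemma is_finite_insert:
  assumes "is_finite X"
  shows "is_finite (insert a X)"
proof (cases "a \<in> X")
  case False
  obtain n g where n: "is_nat n" "is_fun g" "fdom g = elts n" "bij_betw (app g) (elts n) X"
    using assms unfolding is_finite_iff by blast
  \<comment> \<open>The new element gets index \<open>n\<close>; the old values persist because
    \<open>n\<close> is not a member of itself.\<close>
  have "bij_betw (app (fupd g n a)) (elts n) X"
    using n(4) by (rule bij_betw_cong[THEN iffD1, rotated]) auto
  then have "bij_betw (app (fupd g n a)) (insert n (elts n)) (insert a X)"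
    using notIn_Un_bij_betw[of n "elts n" "app (fupd g n a)" X] False by simp
  moreover have "fdom (fupd g n a) = elts (succ n)" using n(3) by simp
  ultimately show ?thesis
    unfolding is_finite_iff using n is_fun_fupd is_nat_succ elts_succ by metis
qed (use assms in \<open>simp add: insert_absorb\<close>)

lemma fupd_in_finite_functions:
  assumes "A \<in> finite_functions U" and "a \<in> U"
  shows "fupd A v a \<in> finite_functions U"
  using assms unfolding finite_functions_eq by (auto simp: is_fun_fupd is_finite_insert)

section \<open>Formation sequences\<close>

text \<open>Every index in \<open>succ n\<close> has its members in \<open>succ n\<close> too, so
  each value consulted lies in the domain of \<open>s\<close>, where \<open>fapp\<close> and
  \<open>app\<close> agree.\<close>

lemma generated_iff:
  "generated step x \<longleftrightarrow>
    (\<exists>n s. is_nat n \<and> s \<in> tuples (succ n) UNIV \<and>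
      (\<forall>i \<in> elts (succ n). step (app s ` elts i) (app s i)) \<and> x = app s n)"
proof -
  have "fapp s i = app s i" "fapp s ` elts i = app s ` elts i"
    if "is_nat n" "s \<in> tuples (succ n) UNIV" "i \<in> elts (succ n)" for n s i
    using that elts_subset_of_is_nat[OF is_nat_succ, of n i]
    by (auto simp: tuples_def fapp_eq_app subset_iff intro!: image_cong)
  moreover have "n \<in> elts (succ n)" for n by simp
  ultimately show ?thesis unfolding generated_def by metis
qed

text \<open>Under the binders, the index \<open>i\<close> is variable 0, the sequence
  \<open>s\<close> is variable 1 and \<open>n\<close> is variable 2, so the parameters start at
  3.\<close>

lemma definable_generated:
  assumes "definable (\<lambda>x. step (app (x 1) ` elts (x 0)) (app (x 1) (x 0)) (\<lambda>n. x (Suc (Suc (Suc n)))))"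
    and "definable_term t"
  shows "definable (\<lambda>x. generated (\<lambda>E y. step E y x) (t x))"
  unfolding generated_iff
  using assms definable_term_shift[OF definable_term_shift[OF assms(2)]]
  by (intro definable_intros) (simp_all add: numeral_2_eq_2)

text \<open>Membership induction on the index: the entries before index \<open>i\<close> are the
  values at the members of \<open>i\<close>.\<close>

lemma generated_induct:
  assumes "generated step x" and "X \<in> Cls"
    and "\<And>E y. step E y \<Longrightarrow> E \<subseteq> X \<Longrightarrow> y \<in> X"
  shows "x \<in> X"
proof -
  obtain n s where n: "is_nat n" and s: "s \<in> tuples (succ n) UNIV"
    and step: "\<And>i. i \<in> elts (succ n) \<Longrightarrow> step (app s ` elts i) (app s i)" and x: "x = app s n"
    using assms(1) unfolding generated_iff by blast
  have "i \<in> elts (succ n) \<longrightarrow> app s i \<in> X" for i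
  proof (rule elts_induct[where a = i])
    show "definable (\<lambda>x. x 0 \<in> elts (succ n) \<longrightarrow> app s (x 0) \<in> X)"
      by (intro definable_intros assms)
  next
    fix i assume IH: "\<And>j. j \<in> elts i \<Longrightarrow> j \<in> elts (succ n) \<longrightarrow> app s j \<in> X"
    show "i \<in> elts (succ n) \<longrightarrow> app s i \<in> X"
    proof
      assume i: "i \<in> elts (succ n)"
      then have "app s ` elts i \<subseteq> X"
        using IH elts_subset_of_is_nat[OF is_nat_succ[OF n] i] by auto
      then show "app s i \<in> X" using assms(3) step[OF i] by blast
    qed
  qed
  then show ?thesis using x by simp
qed

text \<open>The entries of one formation sequence form such a class. It allows reading off how
  \<open>x\<close> and its constituents were formed.\<close>

lemma generated_formation_class:
  assumes "generated step x"
  obtains X where "X \<in> Cls" "x \<in> X" "\<And>y. y \<in> X \<Longrightarrow> \<exists>E \<subseteq> X. step E y"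
proof -
  obtain n s where n: "is_nat n" and s: "s \<in> tuples (succ n) UNIV"
    and step: "\<And>i. i \<in> elts (succ n) \<Longrightarrow> step (app s ` elts i) (app s i)" and x: "x = app s n"
    using assms(1) unfolding generated_iff by blast
  have "{y. \<exists>i \<in> elts (succ n). y = app s i} \<in> Cls"
    by (rule class_of_definable) (intro definable_intros)
  then have "app s ` elts (succ n) \<in> Cls" by (simp only: image_def)
  moreover have "app s ` elts i \<subseteq> app s ` elts (succ n)" if "i \<in> elts (succ n)" for i
    using elts_subset_of_is_nat[OF is_nat_succ[OF n] that] by auto
  ultimately show thesis using step x by (intro that[of "app s ` elts (succ n)"]) auto
qed

text \<open>Put \<open>y\<close> at the end of a formation sequence for \<open>x\<close>; then
  \<open>x\<close> is among the predecessors of \<open>y\<close>.\<close>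

lemma generated_append:
  assumes "generated step x" and "\<And>E. x \<in> E \<Longrightarrow> step E y"
  shows "generated step y"
proof -
  obtain n s where n: "is_nat n" and s: "s \<in> tuples (succ n) UNIV"
    and step: "\<And>i. i \<in> elts (succ n) \<Longrightarrow> step (app s ` elts i) (app s i)" and x: "x = app s n"
    using assms(1) unfolding generated_iff by blast
  define s' where "s' = fupd s (succ n) y"
  \<comment> \<open>The new entry sits at index \<open>succ n\<close>, which is not a member of
    itself, so the old entries are unchanged.\<close>
  have eq: "app s' j = app s j" if "j \<in> elts (succ n)" for j
    using that elts_irrefl[of "succ n"] unfolding s'_def app_fupd by metis
  have "step (app s' ` elts i) (app s' i)" if "i \<in> elts (succ (succ n))" for i
  proof (cases "i \<in> elts (succ n)")
    case True
    then have "app s' ` elts i = app s ` elts i"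
      using elts_subset_of_is_nat[OF is_nat_succ[OF n] True] eq by (intro image_cong) auto
    then show ?thesis using step[OF True] eq[OF True] by simp
  next
    case False
    then have i: "i = succ n" using that by auto
    have "x \<in> app s' ` elts i" unfolding i x using eq[of n] by auto
    then show ?thesis using assms(2) i by (simp add: s'_def)
  qed
  moreover have "s' \<in> tuples (succ (succ n)) UNIV"
    using s by (simp add: s'_def tuples_eq is_fun_fupd)
  moreover have "y = app s' (succ n)" by (simp add: s'_def)
  ultimately show ?thesis unfolding generated_iff using is_nat_succ[OF n] by blast
qed

section \<open>Definability of syntax and semantics\<close>

lemmas fm_defs = eq_fm_def rel_fm_def neg_fm_def conj_fm_def ex_fm_def

lemma definable_unary_syntax [definable_intros]:
  assumes "definable_term t"
  shows "definable_term (\<lambda>x. var (t x))" "definable_term (\<lambda>x. neg_fm (t x))"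
  unfolding var_def fm_defs by (intro definable_intros assms)+

lemma definable_binary_syntax [definable_intros]:
  assumes "definable_term s" and "definable_term t"
  shows "definable_term (\<lambda>x. op_term (s x) (t x))"
    "definable_term (\<lambda>x. eq_fm (s x) (t x))" "definable_term (\<lambda>x. rel_fm (s x) (t x))"
    "definable_term (\<lambda>x. conj_fm (s x) (t x))" "definable_term (\<lambda>x. ex_fm (s x) (t x))"
  unfolding op_term_def fm_defs by (intro definable_intros assms)+

lemma definable_rel_sym [definable_intros]:
  "\<rho> \<in> Cls \<Longrightarrow> definable_term s \<Longrightarrow> definable_term t \<Longrightarrow> definable (\<lambda>x. rel_sym \<rho> (s x) (t x))"
  unfolding rel_sym_def by (intro definable_intros)

lemma definable_op_sym [definable_intros]:
  "\<rho> \<in> Cls \<Longrightarrow> definable_term s \<Longrightarrow> definable_term t \<Longrightarrow> definable (\<lambda>x. op_sym \<rho> (s x) (t x))"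
  unfolding op_sym_def by (intro definable_intros)

lemma variables_class [definable_intros]: "variables \<in> Cls"
  unfolding variables_def by (rule class_of_definable) (intro definable_intros)

text \<open>Formation sequences are sets, so the defining formula binds set variables only and
  comprehension applies.\<close>

lemma terms_class [definable_intros]:
  assumes "\<rho> \<in> Cls"
  shows "terms \<rho> \<in> Cls"
  unfolding terms_def
  by (rule class_of_definable) (intro definable_generated definable_intros assms)

lemma formulas_class [definable_intros]:
  assumes "\<rho> \<in> Cls"
  shows "formulas \<rho> \<in> Cls"
  unfolding formulas_def
  by (rule class_of_definable) (intro definable_generated definable_intros assms)

lemma definable_subformulas [definable_intros]:
  assumes "definable_term t"
  shows "definable_class (\<lambda>x. subformulas (t x))"
  by (rule definable_class_subst[OF _ assms])
     (unfold subformulas_def, intro definable_generated definable_intros)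

lemma occurs_eq:
  "occurs v = generated (\<lambda>E t.
     t = v \<or> (\<exists>f s. t = op_term f s \<and> is_fun s \<and> (\<exists>i \<in> fdom s. app s i \<in> E)))"
  unfolding occurs_def by (simp add: fapp_eq_app cong: conj_cong bex_cong)

lemma definable_occurs [definable_intros]:
  assumes "definable_term s" and "definable_term t"
  shows "definable (\<lambda>x. occurs (s x) (t x))"
  by (rule definable_subst2[OF _ assms])
     (unfold occurs_eq, intro definable_generated definable_intros)

lemma occurs_free_eq:
  "occurs_free v = generated (\<lambda>E \<phi>.
     (\<exists>t u. \<phi> = eq_fm t u \<and> (occurs v t \<or> occurs v u)) \<or>
     (\<exists>R s. \<phi> = rel_fm R s \<and> is_fun s \<and> (\<exists>i \<in> fdom s. occurs v (app s i))) \<or>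
     (\<exists>\<psi> \<in> E. \<phi> = neg_fm \<psi>) \<or>
     (\<exists>\<psi> \<chi>. \<phi> = conj_fm \<psi> \<chi> \<and> (\<psi> \<in> E \<or> \<chi> \<in> E)) \<or>
     (\<exists>u. \<exists>\<psi> \<in> E. u \<noteq> v \<and> \<phi> = ex_fm u \<psi>))"
  unfolding occurs_free_def by (simp add: fapp_eq_app cong: conj_cong bex_cong)

lemma definable_occurs_free [definable_intros]:
  assumes "definable_term s" and "definable_term t"
  shows "definable (\<lambda>x. occurs_free (s x) (t x))"
  by (rule definable_subst2[OF _ assms])
     (unfold occurs_free_eq, intro definable_generated definable_intros)

lemma definable_free_vars [definable_intros]:
  assumes "definable_term t"
  shows "definable_class (\<lambda>x. free_vars (t x))"
  by (rule definable_class_subst[OF _ assms]) (unfold free_vars_def, intro definable_intros)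

lemma universe_class [definable_intros]:
  assumes "S \<in> Cls"
  shows "universe S \<in> Cls"
  unfolding universe_def by (rule class_of_definable) (intro definable_intros assms)

lemma definable_denotation [definable_intros]:
  assumes "S \<in> Cls" and "definable_term t"
  shows "definable_class (\<lambda>x. denotation S (t x))"
  by (rule definable_class_subst[OF _ assms(2)]) (unfold denotation_def, intro definable_intros assms)

lemma fapp_tuple: "s \<in> tuples n U \<Longrightarrow> i \<in> elts n \<Longrightarrow> fapp s i = app s i"
  by (auto simp: tuples_def fapp_eq_app)

lemma term_value_eq:
  "term_value \<rho> S A t a \<longleftrightarrow> generated (\<lambda>E p.
     (\<exists>v \<in> variables. \<exists>b. p = opair v b \<and> opair v b \<in> elts A) \<or>
     (\<exists>f n s w b. p = opair (op_term f s) b \<and> op_sym \<rho> f n \<and>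
        s \<in> tuples n UNIV \<and> w \<in> tuples n UNIV \<and>
        (\<forall>i \<in> elts n. opair (app s i) (app w i) \<in> E) \<and>
        opair w b \<in> denotation S f)) (opair t a)"
  unfolding term_value_def by (simp add: fapp_tuple cong: conj_cong ball_cong)

lemma definable_term_value [definable_intros]:
  assumes "\<rho> \<in> Cls" "S \<in> Cls" and "definable_term s" "definable_term t" "definable_term u"
  shows "definable (\<lambda>x. term_value \<rho> S (s x) (t x) (u x))"
  by (rule definable_subst3[OF _ assms(3-5)])
     (unfold term_value_eq, intro definable_generated definable_intros assms)

lemma definable_evaluable [definable_intros]:
  assumes "S \<in> Cls" "\<Phi> \<in> Cls" and "definable_term s" "definable_term t"
  shows "definable (\<lambda>x. evaluable S \<Phi> (s x) (t x))"
  by (rule definable_subst2[OF _ assms(3,4)])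
     (unfold evaluable_def, intro definable_intros assms)

lemma definable_is_true [definable_intros]:
  assumes "definable_class K" and "definable_term s" "definable_term t"
  shows "definable (\<lambda>x. is_true (K x) (s x) (t x))"
  unfolding is_true_def by (intro definable_intros assms)

section \<open>Induction on formulas\<close>

lemma fm_eq_iff [simp]:
  "eq_fm t u = eq_fm t' u' \<longleftrightarrow> t = t' \<and> u = u'" "rel_fm R s = rel_fm R' s' \<longleftrightarrow> R = R' \<and> s = s'"
  "neg_fm \<phi> = neg_fm \<phi>' \<longleftrightarrow> \<phi> = \<phi>'" "conj_fm \<phi> \<psi> = conj_fm \<phi>' \<psi>' \<longleftrightarrow> \<phi> = \<phi>' \<and> \<psi> = \<psi>'"
  "ex_fm v \<phi> = ex_fm v' \<phi>' \<longleftrightarrow> v = v' \<and> \<phi> = \<phi>'"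
  "eq_fm t u \<noteq> rel_fm R s" "eq_fm t u \<noteq> neg_fm \<phi>" "eq_fm t u \<noteq> conj_fm \<phi> \<psi>" "eq_fm t u \<noteq> ex_fm v \<phi>"
  "rel_fm R s \<noteq> eq_fm t u" "rel_fm R s \<noteq> neg_fm \<phi>" "rel_fm R s \<noteq> conj_fm \<phi> \<psi>" "rel_fm R s \<noteq> ex_fm v \<phi>"
  "neg_fm \<phi> \<noteq> eq_fm t u" "neg_fm \<phi> \<noteq> rel_fm R s" "neg_fm \<phi> \<noteq> conj_fm \<chi> \<psi>" "neg_fm \<phi> \<noteq> ex_fm v \<psi>"
  "conj_fm \<phi> \<psi> \<noteq> eq_fm t u" "conj_fm \<phi> \<psi> \<noteq> rel_fm R s" "conj_fm \<phi> \<psi> \<noteq> neg_fm \<chi>"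
  "conj_fm \<phi> \<psi> \<noteq> ex_fm v \<chi>"
  "ex_fm v \<phi> \<noteq> eq_fm t u" "ex_fm v \<phi> \<noteq> rel_fm R s" "ex_fm v \<phi> \<noteq> neg_fm \<psi>"
  "ex_fm v \<phi> \<noteq> conj_fm \<chi> \<psi>"
  unfolding fm_defs by simp_all

definition immediate_subformula :: "'s \<Rightarrow> 's \<Rightarrow> bool" where
  "immediate_subformula \<psi> \<phi> \<longleftrightarrow>
     \<phi> = neg_fm \<psi> \<or> (\<exists>\<chi>. \<phi> = conj_fm \<psi> \<chi> \<or> \<phi> = conj_fm \<chi> \<psi>) \<or> (\<exists>v. \<phi> = ex_fm v \<psi>)"

text \<open>The witness is the Kuratowski member containing both components, which therefore lie two
  membership levels below the pair.\<close>

lemma opair_components: "\<exists>z \<in> elts (opair a b). a \<in> elts z \<and> b \<in> elts z"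
  unfolding opair_def by (simp add: elts_set_of pairing)

text \<open>Membership induction gives the hypothesis at members only, so the statement is
  strengthened to cover the levels below as well.\<close>

lemma formula_induct:
  assumes "definable (\<lambda>x. P (x 0))"
    and "\<And>\<phi>. (\<And>\<psi>. immediate_subformula \<psi> \<phi> \<Longrightarrow> P \<psi>) \<Longrightarrow> P \<phi>"
  shows "P \<phi>"
proof -
  \<comment> \<open>an immediate subformula lies at \<open>\<in>\<close>-depth at most 4: two nested pairs, each of depth 2\<close>
  define Q where
    "Q x \<longleftrightarrow> P x \<and> (\<forall>a \<in> elts x. P a \<and> (\<forall>b \<in> elts a. P b \<and> (\<forall>c \<in> elts b. P c \<and> (\<forall>d \<in> elts c. P d))))"
    for x
  have "Q \<phi>"
  proof (rule elts_induct)
    show "definable (\<lambda>x. Q (x 0))"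
      unfolding Q_def by (intro definable_intros definable_subst1[OF assms(1)])
  next
    fix x assume IH: "\<And>y. y \<in> elts x \<Longrightarrow> Q y"
    have *: "P \<psi>" if "immediate_subformula \<psi> x" for \<psi>
    proof -
      have 2: "P b" if "a \<in> elts x" "b \<in> elts a" for a b
        using IH that unfolding Q_def by blast
      have 4: "P d" if "a \<in> elts x" "b \<in> elts a" "c \<in> elts b" "d \<in> elts c" for a b c d
        using IH that unfolding Q_def by blast
      from that consider "x = opair (num 4) \<psi>" | k \<chi> where "x = opair k (opair \<psi> \<chi>)"
        | k \<chi> where "x = opair k (opair \<chi> \<psi>)"
        unfolding immediate_subformula_def fm_defs by blast
      then show ?thesis
      proof cases
        case 1 then show ?thesis using 2 opair_components by blast
      next
        case 2 then show ?thesis using 4 opair_components by meson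
      next
        case 3 then show ?thesis using 4 opair_components by meson
      qed
    qed
    show "Q x" using assms(2)[of x, OF *] IH unfolding Q_def by blast
  qed
  then show ?thesis by (simp add: Q_def)
qed

section \<open>Partial valuations\<close>

text \<open>The truth that Tarski's clauses prescribe at one pair when \<open>V\<close> gives the
  values at its constituents. Sets without the shape of a formula come out false. \<open>app\<close>
  replaces \<open>fapp\<close> for definability.\<close>

definition tarski_step :: "'s set \<Rightarrow> 's set \<Rightarrow> 's set \<Rightarrow> 's \<Rightarrow> 's \<Rightarrow> bool" where
  "tarski_step \<rho> S V \<phi> A \<longleftrightarrow>
     (\<exists>t u a. \<phi> = eq_fm t u \<and> term_value \<rho> S A t a \<and> term_value \<rho> S A u a) \<or>
     (\<exists>R s. \<phi> = rel_fm R s \<and> (\<exists>w \<in> denotation S R. fdom w = fdom s \<and>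
              (\<forall>i \<in> fdom s. term_value \<rho> S A (app s i) (app w i)))) \<or>
     (\<exists>\<psi>. \<phi> = neg_fm \<psi> \<and> \<not> is_true V \<psi> A) \<or>
     (\<exists>\<psi> \<chi>. \<phi> = conj_fm \<psi> \<chi> \<and> is_true V \<psi> A \<and> is_true V \<chi> A) \<or>
     (\<exists>v \<psi>. \<phi> = ex_fm v \<psi> \<and> (\<exists>a \<in> universe S. is_true V \<psi> (fupd A v a)))"

text \<open>The pairs at which \<open>tarski_step\<close> consults the valuation.\<close>

definition depends :: "'s set \<Rightarrow> 's \<Rightarrow> 's \<Rightarrow> 's \<Rightarrow> 's \<Rightarrow> bool" where
  "depends S \<phi> A \<psi> B \<longleftrightarrow>
     (\<phi> = neg_fm \<psi> \<and> B = A) \<or>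
     (\<exists>\<chi>. (\<phi> = conj_fm \<psi> \<chi> \<or> \<phi> = conj_fm \<chi> \<psi>) \<and> B = A) \<or>
     (\<exists>v. \<phi> = ex_fm v \<psi> \<and> (\<exists>a \<in> universe S. B = fupd A v a))"

definition decided :: "'s set \<Rightarrow> 's \<Rightarrow> 's \<Rightarrow> bool" where
  "decided V \<phi> A \<longleftrightarrow> (\<exists>e. opair (opair \<phi> A) e \<in> V)"

definition truth_value :: "bool \<Rightarrow> 's" where
  "truth_value P = (if P then num 1 else num 0)"

text \<open>The value is computed from the pair, so uniqueness is built in; the second conjunct
  closes the decided pairs under \<open>depends\<close>. Pairs range over arbitrary sets, to match
  the induction on formulas.\<close>

definition partial_valuation :: "'s set \<Rightarrow> 's set \<Rightarrow> 's set \<Rightarrow> bool" where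
  "partial_valuation \<rho> S V \<longleftrightarrow>
     (\<forall>p \<in> V. \<exists>\<phi> A. p = opair (opair \<phi> A) (truth_value (tarski_step \<rho> S V \<phi> A)) \<and>
                (\<forall>\<psi> B. depends S \<phi> A \<psi> B \<longrightarrow> decided V \<psi> B))"

lemma definable_tarski_step [definable_intros]:
  assumes "\<rho> \<in> Cls" "S \<in> Cls" and "definable_term r" and "definable_term s" "definable_term t"
  shows "definable (\<lambda>x. tarski_step \<rho> S (elts (r x)) (s x) (t x))"
  by (rule definable_subst3[OF _ assms(3-5)])
     (unfold tarski_step_def, intro definable_intros assms)

lemma definable_truth_value [definable_intros]:
  assumes "definable P"
  shows "definable_term (\<lambda>x. truth_value (P x))"
proof -
  have "y = truth_value (P x) \<longleftrightarrow> P x \<and> y = num 1 \<or> \<not> P x \<and> y = num 0" for x y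
    by (simp add: truth_value_def)
  moreover have "definable (\<lambda>x. P (\<lambda>n. x (Suc n)) \<and> x 0 = num 1 \<or> \<not> P (\<lambda>n. x (Suc n)) \<and> x 0 = num 0)"
    by (intro definable_intros definable_shift assms)
  ultimately show ?thesis unfolding definable_term_def by simp
qed

lemma definable_decided [definable_intros]:
  assumes "definable_term r" "definable_term s" "definable_term t"
  shows "definable (\<lambda>x. decided (elts (r x)) (s x) (t x))"
  by (rule definable_subst3[OF _ assms]) (unfold decided_def, intro definable_intros)

text \<open>The valuation is the extension of a set, so later formulas may quantify over partial
  valuations without binding a class variable.\<close>

lemma definable_partial_valuation [definable_intros]:
  assumes "\<rho> \<in> Cls" "S \<in> Cls" and "definable_term t"
  shows "definable (\<lambda>x. partial_valuation \<rho> S (elts (t x)))"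
  by (rule definable_subst1[OF _ assms(3)])
     (unfold partial_valuation_def depends_def, intro definable_intros assms)

lemma tarski_step_cong:
  assumes "\<And>\<psi> B. depends S \<phi> A \<psi> B \<Longrightarrow> is_true V \<psi> B \<longleftrightarrow> is_true W \<psi> B"
  shows "tarski_step \<rho> S V \<phi> A \<longleftrightarrow> tarski_step \<rho> S W \<phi> A"
proof -
  have "(\<exists>\<psi>. \<phi> = neg_fm \<psi> \<and> \<not> is_true V \<psi> A) \<longleftrightarrow> (\<exists>\<psi>. \<phi> = neg_fm \<psi> \<and> \<not> is_true W \<psi> A)"
    using assms unfolding depends_def by blast
  moreover have "(\<exists>\<psi> \<chi>. \<phi> = conj_fm \<psi> \<chi> \<and> is_true V \<psi> A \<and> is_true V \<chi> A) \<longleftrightarrow>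
      (\<exists>\<psi> \<chi>. \<phi> = conj_fm \<psi> \<chi> \<and> is_true W \<psi> A \<and> is_true W \<chi> A)"
    using assms unfolding depends_def by blast
  moreover have "(\<exists>v \<psi>. \<phi> = ex_fm v \<psi> \<and> (\<exists>a \<in> universe S. is_true V \<psi> (fupd A v a))) \<longleftrightarrow>
      (\<exists>v \<psi>. \<phi> = ex_fm v \<psi> \<and> (\<exists>a \<in> universe S. is_true W \<psi> (fupd A v a)))"
    using assms unfolding depends_def by blast
  ultimately show ?thesis unfolding tarski_step_def by (simp only:)
qed

section \<open>Agreement, gluing and extension of partial valuations\<close>

lemma depends_immediate: "depends S \<phi> A \<psi> B \<Longrightarrow> immediate_subformula \<psi> \<phi>"
  unfolding depends_def immediate_subformula_def by blast

lemma truth_value_eq_iff [simp]: "truth_value P = truth_value Q \<longleftrightarrow> P = Q"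
  by (simp add: truth_value_def)

lemma is_true_iff: "is_true V \<phi> A \<longleftrightarrow> opair (opair \<phi> A) (truth_value True) \<in> V"
  by (simp add: is_true_def truth_value_def)

lemma partial_valuationD:
  assumes "partial_valuation \<rho> S V" and "opair (opair \<phi> A) e \<in> V"
  shows "e = truth_value (tarski_step \<rho> S V \<phi> A)"
    and "depends S \<phi> A \<psi> B \<Longrightarrow> decided V \<psi> B"
  using assms unfolding partial_valuation_def by fastforce+

lemma partial_valuation_is_true:
  assumes "partial_valuation \<rho> S V" and "decided V \<phi> A"
  shows "is_true V \<phi> A \<longleftrightarrow> tarski_step \<rho> S V \<phi> A"
    and "opair (opair \<phi> A) e \<in> V \<longleftrightarrow> e = truth_value (is_true V \<phi> A)"
proof -
  obtain e' where e': "opair (opair \<phi> A) e' \<in> V" using assms(2) by (auto simp: decided_def)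
  show 1: "is_true V \<phi> A \<longleftrightarrow> tarski_step \<rho> S V \<phi> A"
    using partial_valuationD(1)[OF assms(1)] e' unfolding is_true_iff by (metis truth_value_eq_iff)
  show "opair (opair \<phi> A) e \<in> V \<longleftrightarrow> e = truth_value (is_true V \<phi> A)"
    using partial_valuationD(1)[OF assms(1)] e' unfolding 1 by metis
qed

text \<open>Induction on \<open>\<phi>\<close> for all assignments at once, since the quantifier
  clause changes the assignment. Both valuations decide every dependency, so the induction
  hypothesis applies there.\<close>

lemma partial_valuations_agree:
  assumes "\<rho> \<in> Cls" "S \<in> Cls"
    and "partial_valuation \<rho> S (elts v)" "partial_valuation \<rho> S (elts w)"
    and "decided (elts v) \<phi> A" "decided (elts w) \<phi> A"
  shows "is_true (elts v) \<phi> A \<longleftrightarrow> is_true (elts w) \<phi> A"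
proof -
  let ?P = "\<lambda>\<phi>. \<forall>A. decided (elts v) \<phi> A \<and> decided (elts w) \<phi> A \<longrightarrow>
    (is_true (elts v) \<phi> A \<longleftrightarrow> is_true (elts w) \<phi> A)"
  have "?P \<phi>"
  proof (rule formula_induct)
    show "definable (\<lambda>x. ?P (x 0))" by (intro definable_intros)
  next
    fix \<phi> assume IH: "\<And>\<psi>. immediate_subformula \<psi> \<phi> \<Longrightarrow> ?P \<psi>"
    show "?P \<phi>"
    proof (intro allI impI; elim conjE)
      fix A assume dec: "decided (elts v) \<phi> A" "decided (elts w) \<phi> A"
      have "tarski_step \<rho> S (elts v) \<phi> A \<longleftrightarrow> tarski_step \<rho> S (elts w) \<phi> A"
      proof (rule tarski_step_cong)
        fix \<psi> B assume d: "depends S \<phi> A \<psi> B"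
        show "is_true (elts v) \<psi> B \<longleftrightarrow> is_true (elts w) \<psi> B"
          using IH[OF depends_immediate[OF d]] partial_valuationD(2)[OF assms(3) _ d]
            partial_valuationD(2)[OF assms(4) _ d] dec unfolding decided_def by blast
      qed
      then show "is_true (elts v) \<phi> A \<longleftrightarrow> is_true (elts w) \<phi> A"
        using partial_valuation_is_true(1) assms(3,4) dec by blast
    qed
  qed
  then show ?thesis using assms by blast
qed

text \<open>An entry of \<open>V\<close> stays correct in \<open>W\<close>, because the clause for
  it looks only at pairs that \<open>V\<close> decides, and there the truth values are
  unchanged.\<close>

lemma partial_valuation_extend:
  assumes pv: "partial_valuation \<rho> S V" and "V \<subseteq> W"
    and true: "\<And>\<psi> B. decided V \<psi> B \<Longrightarrow> is_true W \<psi> B \<longleftrightarrow> is_true V \<psi> B"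
    and "p \<in> V"
  shows "\<exists>\<phi> A. p = opair (opair \<phi> A) (truth_value (tarski_step \<rho> S W \<phi> A)) \<and>
                (\<forall>\<psi> B. depends S \<phi> A \<psi> B \<longrightarrow> decided W \<psi> B)"
proof -
  obtain \<phi> A where p: "p = opair (opair \<phi> A) (truth_value (tarski_step \<rho> S V \<phi> A))"
    and dec: "\<And>\<psi> B. depends S \<phi> A \<psi> B \<Longrightarrow> decided V \<psi> B"
    using assms(1,4) unfolding partial_valuation_def by blast
  have "tarski_step \<rho> S W \<phi> A \<longleftrightarrow> tarski_step \<rho> S V \<phi> A"
    by (rule tarski_step_cong) (use true dec in blast)
  moreover have "decided W \<psi> B" if "depends S \<phi> A \<psi> B" for \<psi> B
    using dec[OF that] \<open>V \<subseteq> W\<close> unfolding decided_def by blast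
  ultimately show ?thesis using p by (intro exI[of _ \<phi>] exI[of _ A]) simp
qed

text \<open>Agreement of the members keeps the union from making true a pair that a member decides
  as false. \<open>X\<close> may be infinite and is used below for the collection of all partial
  valuations.\<close>

lemma partial_valuation_Union:
  assumes "\<rho> \<in> Cls" "S \<in> Cls" and "\<And>v. v \<in> X \<Longrightarrow> partial_valuation \<rho> S (elts v)"
  shows "partial_valuation \<rho> S (\<Union>v\<in>X. elts v)"
  unfolding partial_valuation_def
proof
  let ?W = "\<Union>v\<in>X. elts v"
  fix p assume "p \<in> ?W"
  then obtain v where v: "v \<in> X" "p \<in> elts v" by blast
  show "\<exists>\<phi> A. p = opair (opair \<phi> A) (truth_value (tarski_step \<rho> S ?W \<phi> A)) \<and>
                (\<forall>\<psi> B. depends S \<phi> A \<psi> B \<longrightarrow> decided ?W \<psi> B)"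
  proof (rule partial_valuation_extend[OF assms(3)[OF v(1)] _ _ v(2)])
    show "elts v \<subseteq> ?W" using v by blast
    show "is_true ?W \<psi> B \<longleftrightarrow> is_true (elts v) \<psi> B" if "decided (elts v) \<psi> B" for \<psi> B
    proof
      assume "is_true ?W \<psi> B"
      then obtain w where w: "w \<in> X" "is_true (elts w) \<psi> B" unfolding is_true_def by blast
      then have "decided (elts w) \<psi> B" unfolding is_true_def decided_def by blast
      then show "is_true (elts v) \<psi> B"
        using partial_valuations_agree[OF assms(1,2)] assms(3) v(1) w that by blast
    qed (use v in \<open>auto simp: is_true_def\<close>)
  qed
qed

text \<open>With all dependencies decided, the prescribed values at \<open>\<phi>\<close> are
  adjoined for every assignment in \<open>\<A>\<close> at once; Replacement keeps the result a
  set.\<close>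

lemma partial_valuation_add:
  assumes "\<rho> \<in> Cls" "S \<in> Cls" and pv: "partial_valuation \<rho> S (elts v)"
    and dec: "\<And>A \<psi> B. A \<in> elts \<A> \<Longrightarrow> depends S \<phi> A \<psi> B \<Longrightarrow> decided (elts v) \<psi> B"
  shows "\<exists>v'. partial_valuation \<rho> S (elts v') \<and> (\<forall>A \<in> elts \<A>. decided (elts v') \<phi> A)"
proof -
  let ?F = "\<lambda>A. opair (opair \<phi> A) (truth_value (tarski_step \<rho> S (elts v) \<phi> A))"
  let ?W = "elts v \<union> ?F ` elts \<A>"
  have "is_set ?W"
    by (intro is_set_Un is_set_image is_set_elts) (intro definable_intros assms)
  then obtain v' where v': "elts v' = ?W" unfolding is_set_def by blast
  \<comment> \<open>If an adjoined pair was decided already, its prescribed value is the one it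
    had.\<close>
  have true: "is_true ?W \<psi> B \<longleftrightarrow> is_true (elts v) \<psi> B" if "decided (elts v) \<psi> B" for \<psi> B
    using partial_valuation_is_true(1)[OF pv that] unfolding is_true_iff by auto
  have "partial_valuation \<rho> S ?W"
    unfolding partial_valuation_def
  proof
    fix p assume "p \<in> ?W"
    then consider "p \<in> elts v" | A where "A \<in> elts \<A>" "p = ?F A" by blast
    then show "\<exists>\<phi> A. p = opair (opair \<phi> A) (truth_value (tarski_step \<rho> S ?W \<phi> A)) \<and>
                (\<forall>\<psi> B. depends S \<phi> A \<psi> B \<longrightarrow> decided ?W \<psi> B)"
    proof cases
      case 1
      show ?thesis by (rule partial_valuation_extend[OF pv _ true 1]) auto
    next
      case (2 A)
      have "tarski_step \<rho> S ?W \<phi> A \<longleftrightarrow> tarski_step \<rho> S (elts v) \<phi> A"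
        by (rule tarski_step_cong) (use true dec[OF 2(1)] in blast)
      moreover have "decided ?W \<psi> B" if "depends S \<phi> A \<psi> B" for \<psi> B
        using dec[OF 2(1) that] unfolding decided_def by blast
      ultimately show ?thesis using 2(2) by (intro exI[of _ \<phi>] exI[of _ A]) simp
    qed
  qed
  moreover have "\<forall>A \<in> elts \<A>. decided ?W \<phi> A" unfolding decided_def by blast
  ultimately show ?thesis using v' by metis
qed

section \<open>Existence of partial and total valuations\<close>

lemma universe_is_set:
  assumes "is_set S"
  shows "is_set (universe S)"
proof -
  have "is_set {a. \<exists>p \<in> elts (set_of S). p = opair (num 0) a}"
    by (rule is_set_partial_image) (auto intro!: definable_intros)
  moreover have "{a. \<exists>p \<in> elts (set_of S). p = opair (num 0) a} = universe S"
    by (auto simp: universe_def elts_set_of[OF assms])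
  ultimately show ?thesis by simp
qed

text \<open>The induction claim ranges over all sets \<open>\<A>\<close>, because a quantifier
  passes from \<open>\<A>\<close> to the larger set of all modifications by elements of the
  universe. That this is a set is where the assumption on \<open>S\<close> enters.\<close>

lemma partial_valuation_exists:
  assumes cls: "\<rho> \<in> Cls" "S \<in> Cls" and "is_set S"
  shows "\<exists>v. partial_valuation \<rho> S (elts v) \<and> (\<forall>A \<in> elts \<A>. decided (elts v) \<phi> A)"
proof -
  let ?P = "\<lambda>\<phi>. \<forall>\<A>. \<exists>v. partial_valuation \<rho> S (elts v) \<and> (\<forall>A \<in> elts \<A>. decided (elts v) \<phi> A)"
  have "?P \<phi>"
  proof (rule formula_induct)
    show "definable (\<lambda>x. ?P (x 0))" by (intro definable_intros assms)
  next
    fix \<phi> assume IH: "\<And>\<psi>. immediate_subformula \<psi> \<phi> \<Longrightarrow> ?P \<psi>"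
    show "?P \<phi>"
    proof
      fix \<A>
      have "\<exists>v. partial_valuation \<rho> S (elts v) \<and>
          (\<forall>A \<in> elts \<A>. \<forall>\<psi> B. depends S \<phi> A \<psi> B \<longrightarrow> decided (elts v) \<psi> B)"
      proof -
        consider (neg) \<psi> where "\<phi> = neg_fm \<psi>" | (conj) \<psi> \<chi> where "\<phi> = conj_fm \<psi> \<chi>"
          | (ex) v \<psi> where "\<phi> = ex_fm v \<psi>" | (atomic) "\<nexists>\<psi>. immediate_subformula \<psi> \<phi>"
          unfolding immediate_subformula_def by blast
        then show ?thesis
        proof cases
          case neg
          then have "?P \<psi>" by (intro IH) (simp add: immediate_subformula_def)
          then show ?thesis using neg by (simp add: depends_def)
        next
          case conj
          then have "?P \<psi>" "?P \<chi>" by (auto intro!: IH simp: immediate_subformula_def)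
          then obtain v w where v: "partial_valuation \<rho> S (elts v)" "\<forall>A \<in> elts \<A>. decided (elts v) \<psi> A"
            and w: "partial_valuation \<rho> S (elts w)" "\<forall>A \<in> elts \<A>. decided (elts w) \<chi> A" by meson
          obtain u where u: "elts u = elts v \<union> elts w"
            using is_set_Un[of "elts v" "elts w"] by (auto simp: is_set_def)
          have "partial_valuation \<rho> S (elts u)"
            using partial_valuation_Union[OF cls, of "{v, w}"] v w u by auto
          moreover have "\<forall>A \<in> elts \<A>. decided (elts u) \<psi> A \<and> decided (elts u) \<chi> A"
            using v(2) w(2) unfolding u decided_def by blast
          ultimately show ?thesis using conj by (auto simp: depends_def)
        next
          case (ex y)
          \<comment> \<open>For each \<open>A\<close>, Replacement over the universe collects its
            modifications into a set; Replacement over \<open>\<A>\<close> and Union then give one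
            set \<open>\<B>\<close> of assignments for the body.\<close>
          let ?G = "\<lambda>A. set_of (fupd A y ` universe S)"
          obtain u where u: "universe S = elts u"
            using universe_is_set[OF assms(3)] unfolding is_set_def by metis
          have set: "is_set (fupd A y ` universe S)" for A
            unfolding u by (rule is_set_image) (intro definable_intros)
          have "definable_class (\<lambda>x. fupd (x 0) y ` universe S)"
            unfolding image_def by (intro definable_intros cls)
          then have "is_set (?G ` elts \<A>)"
            using set by (intro is_set_image definable_set_of)
          then have "is_set (\<Union>A\<in>elts \<A>. fupd A y ` universe S)"
            using is_set_Union[of "?G ` elts \<A>"] by (simp add: elts_set_of set)
          then obtain \<B> where \<B>: "elts \<B> = (\<Union>A\<in>elts \<A>. fupd A y ` universe S)"
            unfolding is_set_def by blast
          have "?P \<psi>" using ex by (intro IH) (simp add: immediate_subformula_def)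
          then obtain v where "partial_valuation \<rho> S (elts v)" "\<forall>B \<in> elts \<B>. decided (elts v) \<psi> B"
            by blast
          then show ?thesis using ex \<B> by (auto simp: depends_def)
        next
          case atomic
          \<comment> \<open>Without immediate subformulas there are no dependencies, so the empty
            valuation suffices.\<close>
          have "partial_valuation \<rho> S (elts zero)" by (simp add: partial_valuation_def)
          then show ?thesis using atomic depends_immediate by blast
        qed
      qed
      then show "\<exists>v. partial_valuation \<rho> S (elts v) \<and> (\<forall>A \<in> elts \<A>. decided (elts v) \<phi> A)"
        using partial_valuation_add[OF cls] by meson
    qed
  qed
  then show ?thesis by blast
qed

text \<open>\<open>W\<close> is the union of all set-sized partial valuations, a class because only
  the set \<open>v\<close> is quantified. By gluing it is a partial valuation itself, and it decides
  every pair.\<close>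

lemma total_valuation_exists:
  assumes cls: "\<rho> \<in> Cls" "S \<in> Cls" and "is_set S"
  obtains W where "W \<in> Cls"
    and "\<And>\<phi> A e. opair (opair \<phi> A) e \<in> W \<longleftrightarrow> e = truth_value (is_true W \<phi> A)"
    and "\<And>\<phi> A. is_true W \<phi> A \<longleftrightarrow> tarski_step \<rho> S W \<phi> A"
proof -
  let ?X = "{v. partial_valuation \<rho> S (elts v)}"
  let ?W = "\<Union>v\<in>?X. elts v"
  have "{p. \<exists>v. partial_valuation \<rho> S (elts v) \<and> p \<in> elts v} \<in> Cls"
    by (rule class_of_definable) (intro definable_intros cls)
  moreover have "?W = {p. \<exists>v. partial_valuation \<rho> S (elts v) \<and> p \<in> elts v}" by blast
  ultimately have W: "?W \<in> Cls" by simp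
  have pv: "partial_valuation \<rho> S ?W" by (rule partial_valuation_Union[OF cls]) simp
  have "decided ?W \<phi> A" for \<phi> A
    \<comment> \<open>\<open>succ A\<close> serves as a set of assignments having \<open>A\<close>
      as a member.\<close>
    using partial_valuation_exists[OF assms, of "succ A" \<phi>] unfolding decided_def by auto
  then show thesis
    using that[OF W] partial_valuation_is_true[OF pv] by blast
qed

section \<open>Restriction to evaluable pairs\<close>

lemma subformulas_immediate:
  assumes "\<phi> \<in> subformulas \<chi>" and "immediate_subformula \<psi> \<phi>"
  shows "\<psi> \<in> subformulas \<chi>"
  using assms unfolding subformulas_def mem_Collect_eq immediate_subformula_def
  by (elim generated_append) blast

text \<open>Append \<open>\<phi>\<close> to a formation sequence witnessing the occurrence in
  \<open>\<psi>\<close>; the excluded case is the one where the quantifier binds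
  \<open>v\<close>.\<close>

lemma occurs_free_immediate:
  assumes "occurs_free v \<psi>" and "immediate_subformula \<psi> \<phi>" and "\<phi> \<noteq> ex_fm v \<psi>"
  shows "occurs_free v \<phi>"
  using assms unfolding occurs_free_def immediate_subformula_def
  by (elim generated_append) (elim disjE exE; simp; blast)

text \<open>The only variable that can become free in passing to an immediate subformula is the
  quantified one, and the modified assignment has it in its domain.\<close>

lemma evaluable_depends:
  assumes "evaluable S \<Phi> \<phi> A" and "depends S \<phi> A \<psi> B"
  shows "evaluable S \<Phi> \<psi> B"
proof -
  have imm: "immediate_subformula \<psi> \<phi>" using assms(2) by (rule depends_immediate)
  have "B \<in> finite_functions (universe S)"
    using assms unfolding evaluable_def depends_def by (auto intro: fupd_in_finite_functions)
  moreover have "free_vars \<psi> \<subseteq> fdom B"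
  proof
    fix v assume v: "v \<in> free_vars \<psi>"
    show "v \<in> fdom B"
    proof (cases "\<phi> = ex_fm v \<psi>")
      case True
      then show ?thesis using assms(2) by (auto simp: depends_def)
    next
      case False
      then have "v \<in> free_vars \<phi>"
        using v occurs_free_immediate[OF _ imm] by (auto simp: free_vars_def)
      then have "v \<in> fdom A" using assms(1) by (auto simp: evaluable_def)
      then show ?thesis using assms(2) by (auto simp: depends_def)
    qed
  qed
  ultimately show ?thesis
    using assms(1) subformulas_immediate[OF _ imm] unfolding evaluable_def by blast
qed

text \<open>Supplies that the argument list is a function, which the passage from \<open>app\<close>
  back to \<open>fapp\<close> requires. A formation class of \<open>\<chi>\<close> contains all its
  subformulas, and each member shows how it was formed.\<close>

lemma rel_subformula:
  assumes "\<chi> \<in> formulas \<rho>" and "rel_fm R s \<in> subformulas \<chi>"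
  obtains n where "rel_sym \<rho> R n" "s \<in> tuples n (terms \<rho>)"
proof -
  obtain X where X: "X \<in> Cls" "\<chi> \<in> X"
    and step: "\<And>\<phi>. \<phi> \<in> X \<Longrightarrow> \<exists>E \<subseteq> X.
     (\<exists>t \<in> terms \<rho>. \<exists>u \<in> terms \<rho>. \<phi> = eq_fm t u) \<or>
     (\<exists>R n s. rel_sym \<rho> R n \<and> s \<in> tuples n (terms \<rho>) \<and> \<phi> = rel_fm R s) \<or>
     (\<exists>\<psi> \<in> E. \<phi> = neg_fm \<psi>) \<or>
     (\<exists>\<psi> \<in> E. \<exists>\<chi> \<in> E. \<phi> = conj_fm \<psi> \<chi>) \<or>
     (\<exists>v \<in> variables. \<exists>\<psi> \<in> E. \<phi> = ex_fm v \<psi>)"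
    using assms(1) unfolding formulas_def mem_Collect_eq by (rule generated_formation_class) blast
  \<comment> \<open>Injectivity and distinctness of the constructors identify the constituents with
    earlier entries.\<close>
  have sub: "\<psi> \<in> X" if "\<phi> \<in> X" "immediate_subformula \<psi> \<phi>" for \<phi> \<psi>
    using step[OF that(1)] that(2) unfolding immediate_subformula_def by auto
  have "rel_fm R s \<in> X"
    using assms(2) unfolding subformulas_def mem_Collect_eq
  proof (rule generated_induct[OF _ X(1)])
    fix E \<psi> assume "E \<subseteq> X"
      and "\<psi> = \<chi> \<or> (\<exists>\<chi> \<in> E. \<chi> = neg_fm \<psi> \<or> (\<exists>\<theta>. \<chi> = conj_fm \<psi> \<theta> \<or> \<chi> = conj_fm \<theta> \<psi>) \<or>
               (\<exists>v. \<chi> = ex_fm v \<psi>))"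
    then show "\<psi> \<in> X" using X(2) sub unfolding immediate_subformula_def by blast
  qed
  from step[OF this] show thesis using that by auto
qed

lemma tarski_step_simps:
  "tarski_step \<rho> S V (eq_fm t u) A \<longleftrightarrow> (\<exists>a. term_value \<rho> S A t a \<and> term_value \<rho> S A u a)"
  "tarski_step \<rho> S V (rel_fm R s) A \<longleftrightarrow> (\<exists>w \<in> denotation S R. fdom w = fdom s \<and>
      (\<forall>i \<in> fdom s. term_value \<rho> S A (app s i) (app w i)))"
  "tarski_step \<rho> S V (neg_fm \<psi>) A \<longleftrightarrow> \<not> is_true V \<psi> A"
  "tarski_step \<rho> S V (conj_fm \<psi> \<chi>) A \<longleftrightarrow> is_true V \<psi> A \<and> is_true V \<chi> A"
  "tarski_step \<rho> S V (ex_fm v \<psi>) A \<longleftrightarrow> (\<exists>a \<in> universe S. is_true V \<psi> (fupd A v a))"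
  unfolding tarski_step_def by auto

lemma set_structure_satisfactory:
  assumes cls: "\<rho> \<in> Cls" "S \<in> Cls" and struct: "is_structure \<rho> S" and set: "is_set S"
  shows "satisfactory \<rho> S"
proof -
  let ?\<Phi> = "formulas \<rho>"
  have \<Phi>: "?\<Phi> \<in> Cls" by (intro definable_intros cls)
  obtain W where W: "W \<in> Cls"
    and val: "\<And>\<phi> A e. opair (opair \<phi> A) e \<in> W \<longleftrightarrow> e = truth_value (is_true W \<phi> A)"
    and true: "\<And>\<phi> A. is_true W \<phi> A \<longleftrightarrow> tarski_step \<rho> S W \<phi> A"
    using total_valuation_exists[OF cls set] by blast
  \<comment> \<open>\<open>W\<close> has values at all pairs of sets; a valuation may have them only
    at evaluable pairs.\<close>
  let ?V = "{p. \<exists>\<phi> A e. p = opair (opair \<phi> A) e \<and> evaluable S ?\<Phi> \<phi> A \<and> p \<in> W}"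
  have V: "?V \<in> Cls" by (rule class_of_definable) (intro definable_intros cls W)
  have true_V: "is_true ?V \<phi> A \<longleftrightarrow> is_true W \<phi> A" if "evaluable S ?\<Phi> \<phi> A" for \<phi> A
    using that by (simp add: is_true_def)
  \<comment> \<open>Both argument lists are functions: \<open>s\<close> because it belongs to a
    subformula of a formula, \<open>w\<close> because the structure interprets \<open>R\<close> by
    tuples.\<close>
  have rel: "tarski_step \<rho> S W (rel_fm R s) A \<longleftrightarrow>
      (\<exists>w \<in> denotation S R. fdom w = fdom s \<and>
        (\<forall>i \<in> fdom s. term_value \<rho> S A (fapp s i) (fapp w i)))"
    if rel_evaluable: "evaluable S ?\<Phi> (rel_fm R s) A" for R s A
  proof -
    obtain n where n: "rel_sym \<rho> R n" "s \<in> tuples n (terms \<rho>)"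
      using rel_evaluable rel_subformula unfolding evaluable_def by blast
    then have "is_fun s" "\<And>w. w \<in> denotation S R \<Longrightarrow> is_fun w"
      using struct unfolding is_structure_def tuples_def by blast+
    then show ?thesis by (simp add: tarski_step_simps fapp_eq_app cong: conj_cong bex_cong)
  qed
  \<comment> \<open>Tarski's clauses consult only evaluable pairs, where the restriction agrees with
    \<open>W\<close>.\<close>
  have ev: "evaluable S ?\<Phi> (neg_fm \<psi>) A \<Longrightarrow> evaluable S ?\<Phi> \<psi> A"
    "evaluable S ?\<Phi> (conj_fm \<psi> \<chi>) A \<Longrightarrow> evaluable S ?\<Phi> \<psi> A"
    "evaluable S ?\<Phi> (conj_fm \<psi> \<chi>) A \<Longrightarrow> evaluable S ?\<Phi> \<chi> A"
    "evaluable S ?\<Phi> (ex_fm v \<psi>) A \<Longrightarrow> a \<in> universe S \<Longrightarrow> evaluable S ?\<Phi> \<psi> (fupd A v a)"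
    for \<psi> \<chi> v a A
    by (erule evaluable_depends, unfold depends_def, blast)+
  have "tarski_clauses \<rho> S ?\<Phi> ?V"
    unfolding tarski_clauses_def
  proof (intro conjI allI impI)
    show "is_true ?V (rel_fm R s) A \<longleftrightarrow>
      (\<exists>w \<in> denotation S R. fdom w = fdom s \<and>
        (\<forall>i \<in> fdom s. term_value \<rho> S A (fapp s i) (fapp w i)))"
      if "evaluable S ?\<Phi> (rel_fm R s) A" for R s A
      unfolding true_V[OF that] true by (rule rel[OF that])
    show "is_true ?V (ex_fm v \<psi>) A \<longleftrightarrow> (\<exists>a \<in> universe S. is_true ?V \<psi> (fupd A v a))"
      if "evaluable S ?\<Phi> (ex_fm v \<psi>) A" for v \<psi> A
      unfolding true_V[OF that] true[of "ex_fm v \<psi>"] tarski_step_simps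
      using true_V[OF ev(4)[OF that]] by (intro bex_cong) simp_all
    show "is_true ?V (eq_fm t u) A \<longleftrightarrow> (\<exists>a. term_value \<rho> S A t a \<and> term_value \<rho> S A u a)"
      if "evaluable S ?\<Phi> (eq_fm t u) A" for t u A
      unfolding true_V[OF that] true by (rule tarski_step_simps)
    show "is_true ?V (neg_fm \<psi>) A \<longleftrightarrow> \<not> is_true ?V \<psi> A"
      if "evaluable S ?\<Phi> (neg_fm \<psi>) A" for \<psi> A
      unfolding true_V[OF that] true_V[OF ev(1)[OF that]] true[of "neg_fm \<psi>"]
      by (rule tarski_step_simps)
    show "is_true ?V (conj_fm \<psi> \<chi>) A \<longleftrightarrow> is_true ?V \<psi> A \<and> is_true ?V \<chi> A"
      if "evaluable S ?\<Phi> (conj_fm \<psi> \<chi>) A" for \<psi> \<chi> A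
      unfolding true_V[OF that] true_V[OF ev(2)[OF that]] true_V[OF ev(3)[OF that]]
        true[of "conj_fm \<psi> \<chi>"]
      by (rule tarski_step_simps)
  qed
  moreover have "\<exists>!e. opair (opair \<phi> A) e \<in> ?V" if "evaluable S ?\<Phi> \<phi> A" for \<phi> A
    using that val by simp
  moreover have "\<exists>\<phi> A e. p = opair (opair \<phi> A) e \<and> evaluable S ?\<Phi> \<phi> A \<and> e \<in> {num 0, num 1}"
    if "p \<in> ?V" for p
    using that val by (auto simp: truth_value_def)
  ultimately have "is_valuation \<rho> S ?\<Phi> ?V"
    unfolding is_valuation_def by blast
  moreover have "{p. \<exists>\<phi> A. p = opair \<phi> A \<and> evaluable S ?\<Phi> \<phi> A \<and> is_true ?V \<phi> A} \<in> Cls"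
    by (rule class_of_definable) (intro definable_intros cls V)
  ultimately show ?thesis
    unfolding satisfactory_def is_satisfaction_relation_def using \<Phi> V by blast
qed

end

theorem theorem2p9:
  fixes elts :: "'s \<Rightarrow> 's set" and Cls :: "'s set set" and \<rho> S :: "'s set"
  assumes "GB_without_Infinity elts Cls"
    and "\<rho> \<in> Cls" and "set_universe.is_signature elts \<rho>"
    and "S \<in> Cls" and "set_universe.is_structure elts \<rho> S"
    and "set_universe.is_set elts S"
  shows "GB_without_Infinity.satisfactory elts Cls \<rho> S"
  using GB_without_Infinity.set_structure_satisfactory assms by blast

end
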